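(* Let $Z$ be the Cantor set and let $G_0\subset\mathrm{Homeo}(Z)$ be a finitely generated subgroup such that the flow $(Z,G_0)$ is totally minimal. Let $\mathbb{Z}_2=\{1,-1\}$ and $X=Z\times\mathbb{Z}_2$. Let $U$ be a nonempty clopen proper subset of $Z$, let $\phi:Z\to\mathbb{Z}_2$ be defined by $\phi(z)=-1$ for $z\in U$ and $\phi(z)=1$ for $z\in Z\setminus U$, and let $\Phi$ be the homeomorphism of $X$ given by $\Phi(z,\epsilon)=(z,\phi(z)\epsilon)$. Let $G_0$ act on $X$ by $\gamma(z,\epsilon)=(\gamma z,\epsilon)$, and let $G$ be the subgroup of $\mathrm{Homeo}(X)$ generated by $G_0$ (acting on $X$ in this way) and $\Phi$. Then the flow $(X,G)$ is a PI-flow and its enveloping semigroup $E(X,G)$ has exactly $2^{\mathfrak{c}}$ minimal left ideals, where $\mathfrak{c}=2^{\aleph_0}$.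
   Context: The flow $(Z,G_0)$ is totally minimal if for every $n\in\mathbb{N}$ and every two ordered $n$-tuples of distinct points $(z_1,\dots,z_n)$ and $(w_1,\dots,w_n)$ of $Z$ there is a sequence $\gamma_j\in G_0$ with $\lim_{j\to\infty}\gamma_j(z_i)=w_i$ for $i=1,\dots,n$. A flow $(X,G)$ is a compact Hausdorff space $X$ together with a continuous homomorphism of the topological group $G$ into the group $\mathrm{Homeo}(X)$ of self-homeomorphisms of $X$ (compact-open topology), written $(g,x)\mapsto gx$. It is minimal if every orbit $Gx$ is dense in $X$. A homomorphism of flows is a continuous $G$-equivariant map (automatically surjective when the target is minimal); one also calls it an extension of its target. Enveloping semigroup: $E(X,G)$ is the closure in $X^X$ (product topology) of the set of maps $\{x\mapsto gx : g\in G\}$; it is a semigroup under composition. A left ideal is a nonempty subset $I\subset E(X,G)$ with $E(X,G)\,I\subset I$; it is minimal if it contains no strictly smaller left ideal. Two points $x_1,x_2$ of a flow are proximal if there is a net $g_i\in G$ with $\lim g_ix_1=\lim g_ix_2$. An extension $\phi:W'\to W$ is proximal if any two points with the same image under $\phi$ are proximal. It is equicontinuous if, with $R_\phi=\{(a,b)\in W'\times W':\phi(a)=\phi(b)\}$, for every neighborhood $\alpha$ of the diagonal in $W'\times W'$ there is a neighborhood $\beta$ of the diagonal such that $(ga,gb)\in\alpha$ for all $g\in G$ and all $(a,b)\in\beta\cap R_\phi$ (for metrizable minimal flows such extensions are also called isometric). A minimal flow $(X,G)$ is strictly PI if there are an ordinal $\eta$ and a family of minimal flows $\{W_\iota\}_{\iota\le\eta}$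 such that: $W_0$ is the trivial (one-point) flow; for every $\iota<\eta$ there is a homomorphism $\phi_\iota:W_{\iota+1}\to W_\iota$ which is either proximal or equicontinuous; for every limit ordinal $\nu\le\eta$, $W_\nu$ is the inverse limit of $\{W_\iota\}_{\iota<\nu}$; and $W_\eta=X$. A minimal flow $(X,G)$ is a PI-flow (in particular it is minimal) if there exist a strictly PI flow $\tilde X$ and a proximal homomorphism $\theta:\tilde X\to X$. *)

theory Defs
  imports
    "HOL-Analysis.Analysis"
    "HOL-Library.Equipollence"
    "HOL-Algebra.Bij"
    "HOL-Algebra.Generated_Groups"
begin

section \<open>Homeomorphism groups and flows\<close>

text \<open>Self-maps of \<open>topspace X\<close> are represented by extensional functions, as in
  \<^const>\<open>BijGroup\<close>; the product of \<open>g\<close> and \<open>h\<close> is \<open>g\<close> after \<open>h\<close>.\<close>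

definition Homeo :: "'x topology \<Rightarrow> ('x \<Rightarrow> 'x) monoid" where
  "Homeo X = (BijGroup (topspace X))
     \<lparr>carrier := {f \<in> extensional (topspace X). homeomorphic_map X X f}\<rparr>"

definition compact_open_topology :: "'x topology \<Rightarrow> ('x \<Rightarrow> 'x) topology" where
  "compact_open_topology X =
     topology_generated_by
       {{f \<in> carrier (Homeo X). f ` K \<subseteq> V} | K V. compactin X K \<and> openin X V}"

definition topological_group :: "'g monoid \<Rightarrow> 'g topology \<Rightarrow> bool" where
  "topological_group G T \<longleftrightarrow>
     group G \<and> topspace T = carrier G \<and>
     continuous_map (prod_topology T T) T (\<lambda>(g, h). g \<otimes>\<^bsub>G\<^esub> h) \<and>
     continuous_map T T (\<lambda>g. inv\<^bsub>G\<^esub> g)"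

text \<open>Phase spaces are required to be nonempty.  This is tacit in the usual definitions:
  without it the empty flow would be minimal, homomorphisms to minimal flows need not be
  surjective, and the empty flow would be a proximal extension of every flow.\<close>

definition flow ::
  "'g monoid \<Rightarrow> 'g topology \<Rightarrow> 'x topology \<Rightarrow> ('g \<Rightarrow> 'x \<Rightarrow> 'x) \<Rightarrow> bool" where
  "flow G T X a \<longleftrightarrow>
     topological_group G T \<and>
     compact_space X \<and> Hausdorff_space X \<and> topspace X \<noteq> {} \<and>
     (\<lambda>g. restrict (a g) (topspace X)) \<in> hom G (Homeo X) \<and>
     continuous_map T (compact_open_topology X) (\<lambda>g. restrict (a g) (topspace X))"

definition minimal_flow ::
  "'g monoid \<Rightarrow> 'g topology \<Rightarrow> 'x topology \<Rightarrow> ('g \<Rightarrow> 'x \<Rightarrow> 'x) \<Rightarrow> bool" where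
  "minimal_flow G T X a \<longleftrightarrow>
     flow G T X a \<and>
     (\<forall>x \<in> topspace X. X closure_of ((\<lambda>g. a g x) ` carrier G) = topspace X)"

definition totally_minimal ::
  "'g monoid \<Rightarrow> 'x topology \<Rightarrow> ('g \<Rightarrow> 'x \<Rightarrow> 'x) \<Rightarrow> bool" where
  "totally_minimal G X a \<longleftrightarrow>
     (\<forall>n zs ws. length zs = n \<and> length ws = n \<and> distinct zs \<and> distinct ws \<and>
        set zs \<subseteq> topspace X \<and> set ws \<subseteq> topspace X \<longrightarrow>
        (\<exists>\<gamma> :: nat \<Rightarrow> 'g. range \<gamma> \<subseteq> carrier G \<and>
           (\<forall>i < n. limitin X (\<lambda>j. a (\<gamma> j) (zs ! i)) (ws ! i) sequentially)))"

definition flow_hom ::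
  "'g monoid \<Rightarrow> 'x topology \<Rightarrow> ('g \<Rightarrow> 'x \<Rightarrow> 'x) \<Rightarrow> 'y topology \<Rightarrow> ('g \<Rightarrow> 'y \<Rightarrow> 'y)
     \<Rightarrow> ('x \<Rightarrow> 'y) \<Rightarrow> bool" where
  "flow_hom G X a Y b \<phi> \<longleftrightarrow>
     continuous_map X Y \<phi> \<and>
     (\<forall>g \<in> carrier G. \<forall>x \<in> topspace X. \<phi> (a g x) = b g (\<phi> x))"

definition flow_iso ::
  "'g monoid \<Rightarrow> 'x topology \<Rightarrow> ('g \<Rightarrow> 'x \<Rightarrow> 'x) \<Rightarrow> 'y topology \<Rightarrow> ('g \<Rightarrow> 'y \<Rightarrow> 'y)
     \<Rightarrow> ('x \<Rightarrow> 'y) \<Rightarrow> bool" where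
  "flow_iso G X a Y b \<phi> \<longleftrightarrow> flow_hom G X a Y b \<phi> \<and> homeomorphic_map X Y \<phi>"


section \<open>Enveloping semigroup\<close>

definition enveloping_semigroup ::
  "'g monoid \<Rightarrow> 'x topology \<Rightarrow> ('g \<Rightarrow> 'x \<Rightarrow> 'x) \<Rightarrow> ('x \<Rightarrow> 'x) set" where
  "enveloping_semigroup G X a =
     product_topology (\<lambda>_. X) (topspace X) closure_of
       ((\<lambda>g. restrict (a g) (topspace X)) ` carrier G)"

definition left_ideal ::
  "'g monoid \<Rightarrow> 'x topology \<Rightarrow> ('g \<Rightarrow> 'x \<Rightarrow> 'x) \<Rightarrow> ('x \<Rightarrow> 'x) set \<Rightarrow> bool" where
  "left_ideal G X a I \<longleftrightarrow>
     I \<noteq> {} \<and> I \<subseteq> enveloping_semigroup G X a \<and>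
     (\<forall>p \<in> enveloping_semigroup G X a. \<forall>q \<in> I. compose (topspace X) p q \<in> I)"

definition minimal_left_ideal ::
  "'g monoid \<Rightarrow> 'x topology \<Rightarrow> ('g \<Rightarrow> 'x \<Rightarrow> 'x) \<Rightarrow> ('x \<Rightarrow> 'x) set \<Rightarrow> bool" where
  "minimal_left_ideal G X a I \<longleftrightarrow>
     left_ideal G X a I \<and> (\<nexists>J. left_ideal G X a J \<and> J \<subset> I)"


section \<open>Proximal and equicontinuous extensions\<close>

text \<open>A net \<open>g\<^sub>i\<close> in \<open>G\<close> enters only through its eventuality filter, a proper filter on
  the group containing \<open>carrier G\<close>; every such filter arises from a net.\<close>

definition proximal_pair ::
  "'g monoid \<Rightarrow> 'x topology \<Rightarrow> ('g \<Rightarrow> 'x \<Rightarrow> 'x) \<Rightarrow> 'x \<Rightarrow> 'x \<Rightarrow> bool" where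
  "proximal_pair G X a x1 x2 \<longleftrightarrow>
     (\<exists>(F :: 'g filter) x. F \<noteq> bot \<and> (\<forall>\<^sub>F g in F. g \<in> carrier G) \<and>
        limitin X (\<lambda>g. a g x1) x F \<and> limitin X (\<lambda>g. a g x2) x F)"

definition proximal_extension ::
  "'g monoid \<Rightarrow> 'x topology \<Rightarrow> ('g \<Rightarrow> 'x \<Rightarrow> 'x) \<Rightarrow> 'y topology \<Rightarrow> ('g \<Rightarrow> 'y \<Rightarrow> 'y)
     \<Rightarrow> ('x \<Rightarrow> 'y) \<Rightarrow> bool" where
  "proximal_extension G X a Y b \<phi> \<longleftrightarrow>
     flow_hom G X a Y b \<phi> \<and>
     (\<forall>x1 \<in> topspace X. \<forall>x2 \<in> topspace X. \<phi> x1 = \<phi> x2 \<longrightarrow> proximal_pair G X a x1 x2)"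

definition diagonal_nbhd :: "'x topology \<Rightarrow> ('x \<times> 'x) set \<Rightarrow> bool" where
  "diagonal_nbhd X \<alpha> \<longleftrightarrow>
     \<alpha> \<subseteq> topspace X \<times> topspace X \<and>
     (\<exists>V. openin (prod_topology X X) V \<and> (\<forall>x \<in> topspace X. (x, x) \<in> V) \<and> V \<subseteq> \<alpha>)"

definition equicontinuous_extension ::
  "'g monoid \<Rightarrow> 'x topology \<Rightarrow> ('g \<Rightarrow> 'x \<Rightarrow> 'x) \<Rightarrow> 'y topology \<Rightarrow> ('g \<Rightarrow> 'y \<Rightarrow> 'y)
     \<Rightarrow> ('x \<Rightarrow> 'y) \<Rightarrow> bool" where
  "equicontinuous_extension G X a Y b \<phi> \<longleftrightarrow>
     flow_hom G X a Y b \<phi> \<and>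
     (\<forall>\<alpha>. diagonal_nbhd X \<alpha> \<longrightarrow>
        (\<exists>\<beta>. diagonal_nbhd X \<beta> \<and>
           (\<forall>g \<in> carrier G. \<forall>(x, y) \<in> \<beta>. \<phi> x = \<phi> y \<longrightarrow> (a g x, a g y) \<in> \<alpha>)))"


section \<open>PI-flows\<close>

text \<open>Ordinals are represented by elements of a well-order \<open>r\<close>: the ordinals \<open>\<iota> \<le> \<eta>\<close> are the
  elements of \<^term>\<open>under r \<eta>\<close>, those \<open>\<iota> < \<nu>\<close> the elements of \<^term>\<open>underS r \<nu>\<close>, and \<open>\<kappa> = \<iota> + 1\<close> means
  \<^prop>\<open>underS r \<kappa> = under r \<iota>\<close>.  The
  homomorphisms \<open>\<phi>\<^sub>\<iota> : W\<^sub>\<iota>\<^sub>+\<^sub>1 \<rightarrow> W\<^sub>\<iota>\<close>, their composites and the projections from the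
  limit stages are given together as a coherent system \<open>\<pi> \<iota> \<kappa> : W\<^sub>\<iota> \<rightarrow> W\<^sub>\<kappa>\<close> for
  \<open>\<kappa> \<le> \<iota> \<le> \<eta>\<close>, with respect to which the inverse limits are formed.\<close>

definition PI_tower ::
  "'g monoid \<Rightarrow> 'g topology \<Rightarrow> 'i rel \<Rightarrow> 'i \<Rightarrow> ('i \<Rightarrow> 'w topology) \<Rightarrow> ('i \<Rightarrow> 'g \<Rightarrow> 'w \<Rightarrow> 'w)
     \<Rightarrow> ('i \<Rightarrow> 'i \<Rightarrow> 'w \<Rightarrow> 'w) \<Rightarrow> bool" where
  "PI_tower G T r \<eta> W b \<pi> \<longleftrightarrow>
     Well_order r \<and> \<eta> \<in> Field r \<and>
     (\<forall>\<iota> \<in> under r \<eta>. minimal_flow G T (W \<iota>) (b \<iota>)) \<and>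
     (\<forall>\<iota> \<in> under r \<eta>. \<forall>\<kappa> \<in> under r \<iota>. flow_hom G (W \<iota>) (b \<iota>) (W \<kappa>) (b \<kappa>) (\<pi> \<iota> \<kappa>)) \<and>
     (\<forall>\<iota> \<in> under r \<eta>. \<forall>w \<in> topspace (W \<iota>). \<pi> \<iota> \<iota> w = w) \<and>
     (\<forall>\<iota> \<in> under r \<eta>. \<forall>\<kappa> \<in> under r \<iota>. \<forall>\<mu> \<in> under r \<kappa>. \<forall>w \<in> topspace (W \<iota>).
        \<pi> \<kappa> \<mu> (\<pi> \<iota> \<kappa> w) = \<pi> \<iota> \<mu> w) \<and>
     (\<forall>\<iota> \<in> under r \<eta>. underS r \<iota> = {} \<longrightarrow> (\<exists>w. topspace (W \<iota>) = {w})) \<and>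
     (\<forall>\<kappa> \<in> under r \<eta>. \<forall>\<iota> \<in> underS r \<kappa>. underS r \<kappa> = under r \<iota> \<longrightarrow>
        proximal_extension G (W \<kappa>) (b \<kappa>) (W \<iota>) (b \<iota>) (\<pi> \<kappa> \<iota>) \<or>
        equicontinuous_extension G (W \<kappa>) (b \<kappa>) (W \<iota>) (b \<iota>) (\<pi> \<kappa> \<iota>)) \<and>
     (\<forall>\<nu> \<in> under r \<eta>. underS r \<nu> \<noteq> {} \<and> (\<forall>\<iota> \<in> underS r \<nu>. underS r \<nu> \<noteq> under r \<iota>) \<longrightarrow>
        homeomorphic_map (W \<nu>)
          (subtopology (product_topology W (underS r \<nu>))
             {x. \<forall>\<iota> \<in> underS r \<nu>. \<forall>\<kappa> \<in> under r \<iota>. \<pi> \<iota> \<kappa> (x \<iota>) = x \<kappa>})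
          (\<lambda>w. \<lambda>\<iota> \<in> underS r \<nu>. \<pi> \<nu> \<iota> w))"

text \<open>HOL cannot quantify over all types carrying a flow, so the auxiliary flows live on
  subsets of the type \<open>'g set set\<close>, and so do the ordinals.  This loses no generality.  A
  minimal flow of \<open>G\<close> is a quotient of the space of ultrafilters on \<open>carrier G\<close>, hence it
  injects into \<open>'g set set\<close>.  Stages of a tower whose successor map is an isomorphism can be
  removed; each remaining \<open>\<iota> < \<eta>\<close> separates a new pair of points of the top flow (and fewer
  than \<open>n\<close> of them remain if that flow has \<open>n\<close> points), so the indices \<open>\<iota> \<le> \<eta>\<close> inject
  into \<open>'g set set\<close> as well.  Accordingly, \<open>W\<^sub>\<eta> = X\<close> means an isomorphism of flows.\<close>

definition strictly_PI ::
  "'g monoid \<Rightarrow> 'g topology \<Rightarrow> 'x topology \<Rightarrow> ('g \<Rightarrow> 'x \<Rightarrow> 'x) \<Rightarrow> bool" where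
  "strictly_PI G T X a \<longleftrightarrow>
     minimal_flow G T X a \<and>
     (\<exists>(r :: 'g set set rel) \<eta> (W :: 'g set set \<Rightarrow> 'g set set topology) b \<pi>.
        PI_tower G T r \<eta> W b \<pi> \<and> (\<exists>h. flow_iso G (W \<eta>) (b \<eta>) X a h))"

definition PI_flow ::
  "'g monoid \<Rightarrow> 'g topology \<Rightarrow> 'x topology \<Rightarrow> ('g \<Rightarrow> 'x \<Rightarrow> 'x) \<Rightarrow> bool" where
  "PI_flow G T X a \<longleftrightarrow>
     minimal_flow G T X a \<and>
     (\<exists>(Y :: 'g set set topology) b \<theta>.
        strictly_PI G T Y b \<and> proximal_extension G Y b X a \<theta>)"


section \<open>Skew products over the Cantor set\<close>

definition Cantor_space :: "(nat \<Rightarrow> bool) topology" where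
  "Cantor_space = product_topology (\<lambda>_. discrete_topology UNIV) UNIV"

definition Z2 :: "int set" where
  "Z2 = {1, -1}"

definition skew_space :: "'z topology \<Rightarrow> ('z \<times> int) topology" where
  "skew_space Z = prod_topology Z (discrete_topology Z2)"

definition sign_cocycle :: "'z set \<Rightarrow> 'z \<Rightarrow> int" where
  "sign_cocycle U z = (if z \<in> U then -1 else 1)"

definition skew_flip :: "'z topology \<Rightarrow> 'z set \<Rightarrow> 'z \<times> int \<Rightarrow> 'z \<times> int" where
  "skew_flip Z U = (\<lambda>(z, \<epsilon>) \<in> topspace (skew_space Z). (z, sign_cocycle U z * \<epsilon>))"

definition skew_lift :: "'z topology \<Rightarrow> ('z \<Rightarrow> 'z) \<Rightarrow> 'z \<times> int \<Rightarrow> 'z \<times> int" where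
  "skew_lift Z \<gamma> = (\<lambda>(z, \<epsilon>) \<in> topspace (skew_space Z). (\<gamma> z, \<epsilon>))"

text \<open>A subgroup of \<open>Homeo(X)\<close>, given by its underlying set, as a group, with the topology
  inherited from the compact-open topology.  This is the coarsest group topology making the
  inclusion into \<open>Homeo(X)\<close> continuous, so being a PI-flow is most restrictive for it.\<close>

definition subgroup_of_Homeo :: "'x topology \<Rightarrow> ('x \<Rightarrow> 'x) set \<Rightarrow> ('x \<Rightarrow> 'x) monoid" where
  "subgroup_of_Homeo X H = (Homeo X)\<lparr>carrier := H\<rparr>"

definition subgroup_topology :: "'x topology \<Rightarrow> ('x \<Rightarrow> 'x) set \<Rightarrow> ('x \<Rightarrow> 'x) topology" where
  "subgroup_topology X H = subtopology (compact_open_topology X) H"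

definition skew_group :: "'z topology \<Rightarrow> ('z \<Rightarrow> 'z) set \<Rightarrow> 'z set \<Rightarrow> ('z \<times> int \<Rightarrow> 'z \<times> int) set" where
  "skew_group Z G0 U =
     generate (Homeo (skew_space Z)) (skew_lift Z ` G0 \<union> {skew_flip Z U})"

end

theory Submission
  imports Defs
begin

text \<open>
  The double cover \<open>X = Z \<times> {1, -1}\<close> lies over \<open>Z\<close>, on which the flip acts trivially, and all
  elements of \<open>G\<close> commute with the sign change in the fibres.

  \<^emph>\<open>PI.\<close>  Total minimality brings two given points of \<open>Z\<close> simultaneously into any nonempty open set,
  so \<open>Z\<close> is a proximal extension of the one-point flow.  The cover \<open>X \<rightarrow> Z\<close> is equicontinuous,
  because the two points of a fibre are told apart by a clopen set.  Hence \<open>X \<rightarrow> Z \<rightarrow> point\<close> is already a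
  tower as required and \<open>X\<close> is strictly PI.  Formally, a copy of \<open>X\<close> takes the place of the strictly
  PI flow; this is \<open>PI_flow_if_equicontinuous_over_proximal\<close>.  Some work goes
  into the foundations: \<open>Homeo(X)\<close> is a topological group, and continuous images of flows are flows.

  \<^emph>\<open>Enveloping semigroup.\<close>  It consists of all maps \<open>(z, \<epsilon>) \<mapsto> (h z, s z * \<epsilon>)\<close> with \<open>h : Z \<rightarrow> Z\<close> and
  \<open>s : Z \<rightarrow> {1, -1}\<close> arbitrary (\<open>enveloping_semigroup_eq\<close>).  These maps form a closed set containing \<open>G\<close>.
  Conversely, on finitely many points each of them is approximated by moving the points with
  \<open>s z = -1\<close> into \<open>U\<close> and the others off \<open>U\<close>, flipping, and moving all of them near their targets
  (\<open>fibre_map_approximation\<close>).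

  \<^emph>\<open>Minimal left ideals.\<close>  Composition with a map over a constant \<open>h\<close> shows that every left ideal contains
  a map of the form \<open>(z, \<epsilon>) \<mapsto> (w, s z * \<epsilon>)\<close>.  The left ideal generated by such a map consists of all
  \<open>(z, \<epsilon>) \<mapsto> (w', \<plusminus> s z * \<epsilon>)\<close> with \<open>w' \<in> Z\<close>, and each of its members generates it.  So the minimal left ideals
  correspond to the functions \<open>s\<close> up to a global sign, that is, to the subsets of \<open>Z\<close> omitting a
  fixed point \<open>z0\<close> (\<open>minimal_left_ideals_fibre_maps\<close>).  As \<open>Z\<close> has the cardinality of the continuum \<open>c\<close>,
  there are \<open>2\<^sup>c\<close> of them.
\<close>

section \<open>Homeomorphism groups with the compact-open topology\<close>

lemma carrier_Homeo: "carrier (Homeo X) = {f \<in> extensional (topspace X). homeomorphic_map X X f}"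
  by (simp add: Homeo_def)

lemma Homeo_bij_betw: "f \<in> carrier (Homeo X) \<Longrightarrow> bij_betw f (topspace X) (topspace X)"
  by (auto simp: carrier_Homeo homeomorphic_eq_everything_map bij_betw_def)

lemma Homeo_in_Bij: "f \<in> carrier (Homeo X) \<Longrightarrow> f \<in> Bij (topspace X)"
  using Homeo_bij_betw[of f X] by (simp add: Bij_def carrier_Homeo)

lemma Homeo_continuous: "f \<in> carrier (Homeo X) \<Longrightarrow> continuous_map X X f"
  by (simp add: carrier_Homeo homeomorphic_imp_continuous_map)

lemma Homeo_closed: "f \<in> carrier (Homeo X) \<Longrightarrow> x \<in> topspace X \<Longrightarrow> f x \<in> topspace X"
  using Homeo_bij_betw bij_betwE by fastforce

lemma subgroup_Homeo: "subgroup (carrier (Homeo X)) (BijGroup (topspace X))"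
proof -
  interpret B: group "BijGroup (topspace X)"
    by (rule group_BijGroup)
  show ?thesis
  proof (rule B.subgroupI)
    show "carrier (Homeo X) \<subseteq> carrier (BijGroup (topspace X))"
      using Homeo_in_Bij by (auto simp: BijGroup_def)
    have "homeomorphic_map X X (\<lambda>x\<in>topspace X. x)"
      by (rule homeomorphic_map_eq[of X X id]) auto
    then have "(\<lambda>x\<in>topspace X. x) \<in> carrier (Homeo X)"
      by (simp add: carrier_Homeo)
    then show "carrier (Homeo X) \<noteq> {}" by blast
  next
    fix f assume f: "f \<in> carrier (Homeo X)"
    obtain g where g: "homeomorphic_maps X X f g"
      using f by (auto simp: carrier_Homeo homeomorphic_map_maps)
    let ?h = "\<lambda>x\<in>topspace X. inv_into (topspace X) f x"
    have inv: "inv_into (topspace X) f x = g x" if "x \<in> topspace X" for x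
    proof -
      have "g x \<in> topspace X"
        using g that unfolding homeomorphic_maps_def continuous_map_def by auto
      moreover have "f (g x) = x"
        using g that unfolding homeomorphic_maps_def by simp
      ultimately show ?thesis
        using bij_betw_inv_into_left[OF Homeo_bij_betw[OF f], of "g x"] by simp
    qed
    have "homeomorphic_map X X ?h"
    proof (rule homeomorphic_map_eq)
      show "homeomorphic_map X X g"
        using g by (simp add: homeomorphic_maps_map)
      show "\<And>x. x \<in> topspace X \<Longrightarrow> g x = ?h x"
        using inv by simp
    qed
    then show "inv\<^bsub>BijGroup (topspace X)\<^esub> f \<in> carrier (Homeo X)"
      using inv_BijGroup[OF Homeo_in_Bij[OF f]] by (simp add: carrier_Homeo)
  next
    fix f g assume fg: "f \<in> carrier (Homeo X)" "g \<in> carrier (Homeo X)"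
    have "homeomorphic_map X X (compose (topspace X) f g)"
    proof (rule homeomorphic_map_eq)
      show "homeomorphic_map X X (f \<circ> g)"
        using fg by (simp add: carrier_Homeo homeomorphic_map_compose[of X X g X f])
    qed (simp add: compose_def)
    then show "f \<otimes>\<^bsub>BijGroup (topspace X)\<^esub> g \<in> carrier (Homeo X)"
      using fg[THEN Homeo_in_Bij] by (simp add: BijGroup_def carrier_Homeo)
  qed
qed

lemma group_Homeo: "group (Homeo X)"
  using subgroup.subgroup_is_group[OF subgroup_Homeo group_BijGroup]
  by (simp add: Homeo_def)

lemma mult_Homeo:
  "f \<in> carrier (Homeo X) \<Longrightarrow> g \<in> carrier (Homeo X) \<Longrightarrow>
    f \<otimes>\<^bsub>Homeo X\<^esub> g = compose (topspace X) f g"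
  using Homeo_in_Bij by (auto simp: Homeo_def BijGroup_def)

lemma one_Homeo: "\<one>\<^bsub>Homeo X\<^esub> = (\<lambda>x\<in>topspace X. x)"
  by (simp add: Homeo_def BijGroup_def)

lemma inv_Homeo:
  assumes "f \<in> carrier (Homeo X)"
  shows "inv\<^bsub>Homeo X\<^esub> f = (\<lambda>x\<in>topspace X. inv_into (topspace X) f x)"
proof -
  have "inv\<^bsub>Homeo X\<^esub> f = inv\<^bsub>BijGroup (topspace X)\<^esub> f"
    using group.m_inv_consistent[OF group_BijGroup subgroup_Homeo assms] by (simp add: Homeo_def)
  then show ?thesis
    by (simp add: inv_BijGroup[OF Homeo_in_Bij[OF assms]])
qed

lemma topspace_compact_open_topology: "topspace (compact_open_topology X) = carrier (Homeo X)"
  unfolding compact_open_topology_def topology_generated_by_topspace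
  by (force intro!: exI[of _ "{}"])

lemma openin_compact_open_subbasic:
  "compactin X K \<Longrightarrow> openin X V \<Longrightarrow>
    openin (compact_open_topology X) {f \<in> carrier (Homeo X). f ` K \<subseteq> V}"
  unfolding compact_open_topology_def by (rule topology_generated_by_Basis) blast

lemma continuous_map_into_compact_open:
  assumes "\<And>g. g \<in> topspace T \<Longrightarrow> F g \<in> carrier (Homeo X)"
    and "\<And>K V. compactin X K \<Longrightarrow> openin X V \<Longrightarrow> openin T {g \<in> topspace T. F g ` K \<subseteq> V}"
  shows "continuous_map T (compact_open_topology X) F"
  unfolding compact_open_topology_def
proof (rule continuous_on_generated_topo)
  fix A assume "A \<in> {{f \<in> carrier (Homeo X). f ` K \<subseteq> V} |K V. compactin X K \<and> openin X V}"
  then obtain K V where "compactin X K" "openin X V" "A = {f \<in> carrier (Homeo X). f ` K \<subseteq> V}"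
    by blast
  moreover from this have "F -` A \<inter> topspace T = {g \<in> topspace T. F g ` K \<subseteq> V}"
    using assms(1) by auto
  ultimately show "openin T (F -` A \<inter> topspace T)"
    using assms(2) by simp
next
  show "F ` topspace T \<subseteq> \<Union> {{f \<in> carrier (Homeo X). f ` K \<subseteq> V} |K V. compactin X K \<and> openin X V}"
    using assms(1) topspace_compact_open_topology[of X]
    unfolding compact_open_topology_def topology_generated_by_topspace by auto
qed

text \<open>If \<open>f (h K) \<subseteq> V\<close>, normality puts a neighbourhood \<open>W\<close> of \<open>h K\<close> with compact closure
  inside \<open>f\<^sup>-\<^sup>1 V\<close>; maps sending \<open>K\<close> into \<open>W\<close> followed by maps sending the closure of \<open>W\<close>
  into \<open>V\<close> then send \<open>K\<close> into \<open>V\<close>.\<close>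

lemma continuous_map_compose_compact_open:
  assumes "compact_space X" "Hausdorff_space X"
  shows "continuous_map (prod_topology (compact_open_topology X) (compact_open_topology X))
    (compact_open_topology X) (\<lambda>(f, h). f \<otimes>\<^bsub>Homeo X\<^esub> h)"
proof (rule continuous_map_into_compact_open)
  let ?C = "compact_open_topology X"
  interpret H: group "Homeo X"
    by (rule group_Homeo)
  show "\<And>p. p \<in> topspace (prod_topology ?C ?C)
      \<Longrightarrow> (case p of (f, h) \<Rightarrow> f \<otimes>\<^bsub>Homeo X\<^esub> h) \<in> carrier (Homeo X)"
    by (auto simp: topspace_compact_open_topology)
  fix K V assume K: "compactin X K" and V: "openin X V"
  let ?S = "{p \<in> topspace (prod_topology ?C ?C). (case p of (f, h) \<Rightarrow> f \<otimes>\<^bsub>Homeo X\<^esub> h) ` K \<subseteq> V}"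
  have KX: "K \<subseteq> topspace X"
    using K compactin_subset_topspace by blast
  show "openin (prod_topology ?C ?C) ?S"
  proof (subst openin_subopen, intro ballI)
    fix p assume p: "p \<in> ?S"
    obtain f h where fh: "p = (f, h)" by fastforce
    have f: "f \<in> carrier (Homeo X)" and h: "h \<in> carrier (Homeo X)"
      using p fh by (auto simp: topspace_compact_open_topology)
    have "(f \<otimes>\<^bsub>Homeo X\<^esub> h) ` K \<subseteq> V"
      using p fh by auto
    then have fhK: "f (h x) \<in> V" if "x \<in> K" for x
      using that KX by (auto simp: mult_Homeo[OF f h] compose_def)
    have "closedin X (h ` K)"
      by (rule compactin_imp_closedin[OF assms(2) image_compactin[OF K Homeo_continuous[OF h]]])
    moreover have "openin X {x \<in> topspace X. f x \<in> V}"
      by (rule openin_continuous_map_preimage[OF Homeo_continuous[OF f] V])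
    moreover have "h ` K \<subseteq> {x \<in> topspace X. f x \<in> V}"
      using fhK KX Homeo_closed[OF h] by auto
    ultimately obtain W where W: "openin X W" "h ` K \<subseteq> W"
        "X closure_of W \<subseteq> {x \<in> topspace X. f x \<in> V}"
      using compact_Hausdorff_or_regular_imp_normal_space[of X] assms
      unfolding normal_space_alt by meson
    have comp: "compactin X (X closure_of W)"
      by (rule closedin_compact_space[OF assms(1) closedin_closure_of])
    have sub: "W \<subseteq> X closure_of W"
      by (rule closure_of_subset[OF openin_subset[OF W(1)]])
    let ?N = "{f \<in> carrier (Homeo X). f ` (X closure_of W) \<subseteq> V} \<times> {h \<in> carrier (Homeo X). h ` K \<subseteq> W}"
    have "openin (prod_topology ?C ?C) ?N"
      using openin_compact_open_subbasic comp V K W(1) by (auto simp: openin_prod_Times_iff)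
    moreover have "p \<in> ?N"
      using W(2,3) f h fh by auto
    moreover have "?N \<subseteq> ?S"
    proof
      fix q assume "q \<in> ?N"
      then obtain f' h' where q: "q = (f', h')" "f' \<in> carrier (Homeo X)" "h' \<in> carrier (Homeo X)"
          "f' ` (X closure_of W) \<subseteq> V" "h' ` K \<subseteq> W"
        by auto
      have "(f' \<otimes>\<^bsub>Homeo X\<^esub> h') x \<in> V" if "x \<in> K" for x
        using q that sub KX by (auto simp: mult_Homeo[OF q(2,3)] compose_def)
      then show "q \<in> ?S"
        using q by (auto simp: topspace_compact_open_topology)
    qed
    ultimately show "\<exists>N. openin (prod_topology ?C ?C) N \<and> p \<in> N \<and> N \<subseteq> ?S"
      by blast
  qed
qed

lemma continuous_map_inv_compact_open:
  assumes "compact_space X" "Hausdorff_space X"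
  shows "continuous_map (compact_open_topology X) (compact_open_topology X) (\<lambda>f. inv\<^bsub>Homeo X\<^esub> f)"
proof (rule continuous_map_into_compact_open)
  let ?C = "compact_open_topology X"
  interpret H: group "Homeo X"
    by (rule group_Homeo)
  show "\<And>f. f \<in> topspace ?C \<Longrightarrow> inv\<^bsub>Homeo X\<^esub> f \<in> carrier (Homeo X)"
    by (simp add: topspace_compact_open_topology)
  fix K V assume K: "compactin X K" and V: "openin X V"
  have KX: "K \<subseteq> topspace X"
    using K compactin_subset_topspace by blast
  \<comment> \<open>\<open>f\<^sup>-\<^sup>1 K \<subseteq> V\<close> says that \<open>f\<close> maps the complement of \<open>V\<close> into the complement of \<open>K\<close>, and
    compact and closed sets coincide.\<close>
  have eq: "(inv\<^bsub>Homeo X\<^esub> f) ` K \<subseteq> V \<longleftrightarrow> f ` (topspace X - V) \<subseteq> topspace X - K"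
    if f: "f \<in> carrier (Homeo X)" for f
  proof -
    have b: "bij_betw f (topspace X) (topspace X)"
      by (rule Homeo_bij_betw[OF f])
    have "(inv\<^bsub>Homeo X\<^esub> f) ` K \<subseteq> V \<longleftrightarrow> (\<forall>y\<in>K. inv_into (topspace X) f y \<in> V)"
      using KX by (auto simp: inv_Homeo[OF f])
    also have "\<dots> \<longleftrightarrow> (\<forall>x\<in>topspace X. f x \<in> K \<longrightarrow> x \<in> V)"
    proof safe
      fix x assume "\<forall>y\<in>K. inv_into (topspace X) f y \<in> V" "x \<in> topspace X" "f x \<in> K"
      then show "x \<in> V"
        using bij_betw_inv_into_left[OF b] by metis
    next
      fix y assume "\<forall>x\<in>topspace X. f x \<in> K \<longrightarrow> x \<in> V" "y \<in> K"
      then show "inv_into (topspace X) f y \<in> V"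
        using bij_betw_inv_into_right[OF b] KX bij_betwE[OF bij_betw_inv_into[OF b]] by (metis subsetD)
    qed
    also have "\<dots> \<longleftrightarrow> f ` (topspace X - V) \<subseteq> topspace X - K"
      using Homeo_closed[OF f] by auto
    finally show ?thesis .
  qed
  have "compactin X (topspace X - V)"
    using V by (intro closedin_compact_space[OF assms(1)]) auto
  moreover have "openin X (topspace X - K)"
    by (intro openin_diff openin_topspace compactin_imp_closedin[OF assms(2) K])
  ultimately have "openin ?C {f \<in> carrier (Homeo X). f ` (topspace X - V) \<subseteq> topspace X - K}"
    by (rule openin_compact_open_subbasic)
  then show "openin ?C {f \<in> topspace ?C. (inv\<^bsub>Homeo X\<^esub> f) ` K \<subseteq> V}"
    using eq by (simp add: topspace_compact_open_topology cong: conj_cong)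
qed

lemma topological_group_Homeo:
  "compact_space X \<Longrightarrow> Hausdorff_space X \<Longrightarrow>
    topological_group (Homeo X) (compact_open_topology X)"
  by (simp add: topological_group_def group_Homeo continuous_map_compose_compact_open
      continuous_map_inv_compact_open topspace_compact_open_topology)

lemma topological_group_subgroup:
  assumes "topological_group G T" "subgroup H G"
  shows "topological_group (G\<lparr>carrier := H\<rparr>) (subtopology T H)"
proof -
  interpret G: group G
    using assms(1) by (simp add: topological_group_def)
  interpret H: subgroup H G
    by (rule assms(2))
  have top: "topspace (subtopology T H) = H"
    using assms(1) H.subset by (auto simp: topological_group_def)
  have mult: "continuous_map (prod_topology T T) T (\<lambda>(g, h). g \<otimes>\<^bsub>G\<^esub> h)"
    and inv: "continuous_map T T (\<lambda>g. inv\<^bsub>G\<^esub> g)"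
    using assms(1) by (auto simp: topological_group_def)
  have "continuous_map (prod_topology (subtopology T H) (subtopology T H)) (subtopology T H)
      (\<lambda>(g, h). g \<otimes>\<^bsub>G\<^esub> h)"
  proof (rule continuous_map_into_subtopology)
    show "continuous_map (prod_topology (subtopology T H) (subtopology T H)) T (\<lambda>(g, h). g \<otimes>\<^bsub>G\<^esub> h)"
      unfolding subtopology_Times[symmetric] by (rule continuous_map_from_subtopology[OF mult])
  qed (use top in auto)
  moreover have "continuous_map (subtopology T H) (subtopology T H) (\<lambda>g. inv\<^bsub>G\<lparr>carrier := H\<rparr>\<^esub> g)"
  proof (rule continuous_map_eq)
    show "continuous_map (subtopology T H) (subtopology T H) (\<lambda>g. inv\<^bsub>G\<^esub> g)"
      using continuous_map_from_subtopology[OF inv] top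
      by (auto intro!: continuous_map_into_subtopology)
  qed (use top in \<open>auto simp: G.m_inv_consistent[OF assms(2)]\<close>)
  ultimately show ?thesis
    using top H.subgroup_is_group[OF G.is_group] by (simp add: topological_group_def)
qed

lemma flow_subgroup_of_Homeo:
  assumes "compact_space X" "Hausdorff_space X" "topspace X \<noteq> {}" "subgroup H (Homeo X)"
  shows "flow (subgroup_of_Homeo X H) (subgroup_topology X H) X (\<lambda>g. g)"
proof -
  have res: "restrict g (topspace X) = g" if "g \<in> carrier (Homeo X)" for g
    using that by (auto simp: carrier_Homeo extensional_restrict)
  have sub: "H \<subseteq> carrier (Homeo X)"
    using assms(4) by (rule subgroup.subset)
  have "(\<lambda>g. restrict g (topspace X)) \<in> hom (subgroup_of_Homeo X H) (Homeo X)"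
  proof (rule homI)
    show "\<And>g. g \<in> carrier (subgroup_of_Homeo X H) \<Longrightarrow> restrict g (topspace X) \<in> carrier (Homeo X)"
      using sub res by (auto simp: subgroup_of_Homeo_def)
    show "\<And>g h. g \<in> carrier (subgroup_of_Homeo X H) \<Longrightarrow> h \<in> carrier (subgroup_of_Homeo X H) \<Longrightarrow>
        restrict (g \<otimes>\<^bsub>subgroup_of_Homeo X H\<^esub> h) (topspace X)
          = restrict g (topspace X) \<otimes>\<^bsub>Homeo X\<^esub> restrict h (topspace X)"
      using sub res subgroup.m_closed[OF assms(4)] by (auto simp: subgroup_of_Homeo_def subset_iff)
  qed
  moreover have "continuous_map (subgroup_topology X H) (compact_open_topology X)
      (\<lambda>g. restrict g (topspace X))"
  proof (rule continuous_map_eq)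
    show "continuous_map (subgroup_topology X H) (compact_open_topology X) (\<lambda>g. g)"
      by (simp add: subgroup_topology_def continuous_map_from_subtopology)
  qed (use sub res in \<open>auto simp: subgroup_topology_def\<close>)
  ultimately show ?thesis
    using topological_group_subgroup[OF topological_group_Homeo[OF assms(1,2)] assms(4)] assms(1-3)
    by (simp add: flow_def subgroup_of_Homeo_def subgroup_topology_def)
qed

section \<open>Factors of flows\<close>

lemma flow_action_closed:
  assumes "flow G T X a" "g \<in> carrier G" "x \<in> topspace X"
  shows "a g x \<in> topspace X"
proof -
  have "restrict (a g) (topspace X) \<in> carrier (Homeo X)"
    using assms by (auto simp: flow_def dest: hom_in_carrier)
  from Homeo_closed[OF this assms(3)] show ?thesis
    using assms(3) by simp
qed

text \<open>A continuous image of a flow carries a flow as soon as the action descends to it: for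
  \<open>K\<close> compact and \<open>V\<close> open below, \<open>g K \<subseteq> V\<close> is equivalent to the same condition on the
  preimages of \<open>K\<close> and \<open>V\<close> above, so continuity in the compact-open topology passes to the
  image.  Copies of a flow on another type are the special case of a homeomorphism.\<close>

lemma factor_flow:
  assumes fl: "flow G T X a"
    and cont: "continuous_map X Y q" and surj: "q ` topspace X = topspace Y"
    and haus: "Hausdorff_space Y"
    and equiv: "\<And>g x. g \<in> carrier G \<Longrightarrow> x \<in> topspace X \<Longrightarrow> q (a g x) = b g (q x)"
  shows "flow G T Y b"
proof -
  let ?a = "\<lambda>g. restrict (a g) (topspace X)" and ?b = "\<lambda>g. restrict (b g) (topspace Y)"
  have top: "topological_group G T" and comp: "compact_space X" and ne: "topspace X \<noteq> {}"
    and hom: "?a \<in> hom G (Homeo X)" and acont: "continuous_map T (compact_open_topology X) ?a"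
    using fl by (auto simp: flow_def)
  interpret G: group G
    using top by (simp add: topological_group_def)
  have TG: "topspace T = carrier G"
    using top by (simp add: topological_group_def)
  have quot: "quotient_map X Y q"
    by (rule continuous_imp_quotient_map[OF cont comp haus surj])
  have qX: "q x \<in> topspace Y" if "x \<in> topspace X" for x
    using surj that by blast
  have aH: "?a g \<in> carrier (Homeo X)" if "g \<in> carrier G" for g
    using hom that by (rule hom_in_carrier)
  have aX: "a g x \<in> topspace X" if "g \<in> carrier G" "x \<in> topspace X" for g x
    using flow_action_closed[OF fl that] .
  have bY: "b g y \<in> topspace Y" if "g \<in> carrier G" "y \<in> topspace Y" for g y
    using that surj aX equiv qX by (metis imageE)
  have amult: "a (g \<otimes>\<^bsub>G\<^esub> h) x = a g (a h x)"
    if "g \<in> carrier G" "h \<in> carrier G" "x \<in> topspace X" for g h x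
  proof -
    have "?a (g \<otimes>\<^bsub>G\<^esub> h) x = compose (topspace X) (?a g) (?a h) x"
      using hom_mult[OF hom that(1,2)] mult_Homeo[OF aH aH] that by metis
    then show ?thesis
      using that aX by (simp add: compose_def)
  qed
  have bmult: "b (g \<otimes>\<^bsub>G\<^esub> h) y = b g (b h y)"
    if "g \<in> carrier G" "h \<in> carrier G" and y: "y \<in> topspace Y" for g h y
  proof -
    obtain x where x: "x \<in> topspace X" "y = q x"
      using surj y by blast
    have "b (g \<otimes>\<^bsub>G\<^esub> h) (q x) = q (a (g \<otimes>\<^bsub>G\<^esub> h) x)"
      using that x by (simp add: equiv)
    also have "\<dots> = b g (b h (q x))"
      using that x aX by (simp add: amult equiv)
    finally show ?thesis
      using x by simp
  qed
  have aone: "a \<one>\<^bsub>G\<^esub> x = x" if "x \<in> topspace X" for x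
  proof -
    have "?a \<one>\<^bsub>G\<^esub> = \<one>\<^bsub>Homeo X\<^esub>"
      by (rule hom_one[OF hom G.is_group group_Homeo])
    then show ?thesis
      using that by (metis (no_types, lifting) one_Homeo restrict_apply')
  qed
  have bone: "b \<one>\<^bsub>G\<^esub> y = y" if "y \<in> topspace Y" for y
    using that surj aone equiv by (metis G.one_closed imageE)
  have bcont: "continuous_map Y Y (b g)" if g: "g \<in> carrier G" for g
  proof (rule continuous_compose_quotient_map[OF quot])
    have "continuous_map X X (a g)"
      by (rule continuous_map_eq[OF Homeo_continuous[OF aH[OF g]]]) simp
    then have "continuous_map X Y (q \<circ> a g)"
      using cont by (rule continuous_map_compose)
    then show "continuous_map X Y (b g \<circ> q)"
      by (rule continuous_map_eq) (simp add: equiv g)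
  qed
  have bH: "?b g \<in> carrier (Homeo Y)" if g: "g \<in> carrier G" for g
  proof -
    have "homeomorphic_maps Y Y (b g) (b (inv\<^bsub>G\<^esub> g))"
      unfolding homeomorphic_maps_def
      using bcont g bmult[of g "inv\<^bsub>G\<^esub> g"] bmult[of "inv\<^bsub>G\<^esub> g" g] by (simp add: bone)
    then have "homeomorphic_map Y Y (b g)"
      by (simp add: homeomorphic_maps_map)
    then have "homeomorphic_map Y Y (?b g)"
      by (rule homeomorphic_map_eq) simp
    then show ?thesis
      by (simp add: carrier_Homeo)
  qed
  have "?b \<in> hom G (Homeo Y)"
  proof (rule homI)
    fix g h assume gh: "g \<in> carrier G" "h \<in> carrier G"
    show "?b (g \<otimes>\<^bsub>G\<^esub> h) = ?b g \<otimes>\<^bsub>Homeo Y\<^esub> ?b h"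
      unfolding mult_Homeo[OF bH[OF gh(1)] bH[OF gh(2)]]
      by (rule ext) (simp add: compose_def restrict_def bmult[OF gh] bY gh)
  qed (rule bH)
  moreover have "continuous_map T (compact_open_topology Y) ?b"
  proof (rule continuous_map_into_compact_open)
    show "\<And>g. g \<in> topspace T \<Longrightarrow> ?b g \<in> carrier (Homeo Y)"
      using bH TG by simp
    fix K V assume K: "compactin Y K" and V: "openin Y V"
    let ?K = "{x \<in> topspace X. q x \<in> K}" and ?V = "{x \<in> topspace X. q x \<in> V}"
    have "closedin X ?K"
      by (rule closedin_continuous_map_preimage[OF cont compactin_imp_closedin[OF haus K]])
    then have "compactin X ?K"
      by (rule closedin_compact_space[OF comp])
    moreover have "openin X ?V"
      by (rule openin_continuous_map_preimage[OF cont V])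
    ultimately have "openin (compact_open_topology X) {f \<in> carrier (Homeo X). f ` ?K \<subseteq> ?V}"
      by (rule openin_compact_open_subbasic)
    then have "openin T {g \<in> topspace T. ?a g \<in> {f \<in> carrier (Homeo X). f ` ?K \<subseteq> ?V}}"
      by (rule openin_continuous_map_preimage[OF acont])
    moreover have "?a g ` ?K \<subseteq> ?V \<longleftrightarrow> ?b g ` K \<subseteq> V" if g: "g \<in> carrier G" for g
    proof -
      have KY: "K \<subseteq> topspace Y"
        using K by (rule compactin_subset_topspace)
      have "?a g ` ?K \<subseteq> ?V \<longleftrightarrow> (\<forall>x\<in>topspace X. q x \<in> K \<longrightarrow> b g (q x) \<in> V)"
        using g aX equiv by (auto simp: image_subset_iff)
      also have "\<dots> \<longleftrightarrow> (\<forall>y\<in>K. b g y \<in> V)"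
        using KY surj by (metis (no_types, lifting) imageE subsetD qX)
      also have "\<dots> \<longleftrightarrow> ?b g ` K \<subseteq> V"
        using KY by (auto simp: image_subset_iff)
      finally show ?thesis .
    qed
    ultimately show "openin T {g \<in> topspace T. ?b g ` K \<subseteq> V}"
      using aH TG by (simp cong: conj_cong)
  qed
  moreover have "compact_space Y"
    using image_compactin[OF comp[unfolded compact_space_def] cont] surj by (simp add: compact_space_def)
  ultimately show ?thesis
    using top haus ne surj by (auto simp: flow_def)
qed

lemma factor_minimal_flow:
  assumes "minimal_flow G T X a"
    and cont: "continuous_map X Y q" and surj: "q ` topspace X = topspace Y"
    and "Hausdorff_space Y"
    and equiv: "\<And>g x. g \<in> carrier G \<Longrightarrow> x \<in> topspace X \<Longrightarrow> q (a g x) = b g (q x)"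
  shows "minimal_flow G T Y b"
proof -
  have fl: "flow G T X a" and
    dense: "\<And>x. x \<in> topspace X \<Longrightarrow> X closure_of ((\<lambda>g. a g x) ` carrier G) = topspace X"
    using assms(1) by (auto simp: minimal_flow_def)
  have "Y closure_of ((\<lambda>g. b g y) ` carrier G) = topspace Y" if y: "y \<in> topspace Y" for y
  proof -
    obtain x where x: "x \<in> topspace X" "y = q x"
      using surj y by blast
    have "topspace Y = q ` (X closure_of ((\<lambda>g. a g x) ` carrier G))"
      using dense[OF x(1)] surj by simp
    also have "\<dots> \<subseteq> Y closure_of (q ` (\<lambda>g. a g x) ` carrier G)"
      by (rule continuous_map_image_closure_subset[OF cont])
    also have "q ` (\<lambda>g. a g x) ` carrier G = (\<lambda>g. b g y) ` carrier G"
      using x equiv by (auto simp: image_image intro!: image_cong)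
    finally show ?thesis
      by (simp add: closure_of_subset_topspace subset_antisym)
  qed
  moreover have "flow G T Y b"
    by (rule factor_flow[OF fl cont surj assms(4)]) (rule equiv)
  ultimately show ?thesis
    by (simp add: minimal_flow_def)
qed

section \<open>Proximality and equicontinuity criteria\<close>

text \<open>The sets of group elements that move both points into a given neighbourhood of \<open>x\<close> form the
  base of a filter, which plays the role of the net.\<close>

lemma proximal_pairI:
  assumes x: "x \<in> topspace X"
    and ex: "\<And>V. openin X V \<Longrightarrow> x \<in> V \<Longrightarrow> \<exists>g\<in>carrier G. a g x1 \<in> V \<and> a g x2 \<in> V"
  shows "proximal_pair G X a x1 x2"
proof -
  define S where "S V = {g \<in> carrier G. a g x1 \<in> V \<and> a g x2 \<in> V}" for V
  let ?N = "{V. openin X V \<and> x \<in> V}"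
  define F where "F = (INF V\<in>?N. principal (S V))"
  have ev: "eventually P F \<longleftrightarrow> (\<exists>V\<in>?N. \<forall>g\<in>S V. P g)" for P
    unfolding F_def
  proof (subst eventually_INF_base)
    show "?N \<noteq> {}"
      using x openin_topspace by blast
    fix V W assume "V \<in> ?N" "W \<in> ?N"
    then have "V \<inter> W \<in> ?N" "S (V \<inter> W) \<subseteq> S V \<inter> S W"
      by (auto simp: S_def)
    then show "\<exists>V'\<in>?N. principal (S V') \<le> inf (principal (S V)) (principal (S W))"
      by auto
  qed (simp add: eventually_principal)
  have "S V \<noteq> {}" if "V \<in> ?N" for V
    using ex[of V] that by (auto simp: S_def)
  then have "F \<noteq> bot"
    unfolding trivial_limit_def ev by blast
  moreover have "\<forall>\<^sub>F g in F. g \<in> carrier G"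
    unfolding ev using x openin_topspace by (auto simp: S_def)
  moreover have "limitin X (\<lambda>g. a g x1) x F" "limitin X (\<lambda>g. a g x2) x F"
    using x by (auto simp: limitin_def ev S_def)
  ultimately show ?thesis
    unfolding proximal_pair_def by blast
qed

lemma proximal_pair_flow_hom:
  assumes hom: "flow_hom G X a Y b q" and x: "x1 \<in> topspace X" "x2 \<in> topspace X"
    and "proximal_pair G X a x1 x2"
  shows "proximal_pair G Y b (q x1) (q x2)"
proof -
  obtain F x where F: "F \<noteq> bot" "\<forall>\<^sub>F g in F. g \<in> carrier G"
      and lim: "limitin X (\<lambda>g. a g x1) x F" "limitin X (\<lambda>g. a g x2) x F"
    using assms(4) by (auto simp: proximal_pair_def)
  have cont: "continuous_map X Y q"
    and equiv: "\<And>g x. g \<in> carrier G \<Longrightarrow> x \<in> topspace X \<Longrightarrow> q (a g x) = b g (q x)"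
    using hom by (auto simp: flow_hom_def)
  have "limitin Y (\<lambda>g. b g (q y)) (q x) F"
    if "limitin X (\<lambda>g. a g y) x F" "y \<in> topspace X" for y
  proof (rule limitin_transform_eventually)
    show "limitin Y (q \<circ> (\<lambda>g. a g y)) (q x) F"
      by (rule continuous_map_limit[OF cont that(1)])
    show "\<forall>\<^sub>F g in F. (q \<circ> (\<lambda>g. a g y)) g = b g (q y)"
      using F(2) by eventually_elim (simp add: equiv that(2))
  qed
  then show ?thesis
    unfolding proximal_pair_def using F lim x by blast
qed

lemma proximal_pair_refl:
  assumes "flow G T X a" "x \<in> topspace X"
  shows "proximal_pair G X a x x"
proof -
  have "\<one>\<^bsub>G\<^esub> \<in> carrier G"
    using assms(1) by (simp add: flow_def topological_group_def group.is_monoid monoid.one_closed)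
  then have "a \<one>\<^bsub>G\<^esub> x \<in> topspace X"
    using flow_action_closed[OF assms(1) _ assms(2)] by blast
  then show ?thesis
    by (rule proximal_pairI) (use \<open>\<one>\<^bsub>G\<^esub> \<in> carrier G\<close> in blast)
qed

text \<open>The locally constant label \<open>\<sigma>\<close> cuts out the neighbourhood \<open>\<sigma> x = \<sigma> y\<close> of the diagonal, which
  meets the fibre relation of \<open>\<phi>\<close> in the diagonal only.\<close>

lemma equicontinuous_extension_if_separated_by_labels:
  assumes hom: "flow_hom G X a Y b \<phi>" and "flow G T X a"
    and \<sigma>: "continuous_map X (discrete_topology S) \<sigma>"
    and sep: "\<And>x y. x \<in> topspace X \<Longrightarrow> y \<in> topspace X \<Longrightarrow> \<phi> x = \<phi> y \<Longrightarrow> \<sigma> x = \<sigma> y \<Longrightarrow> x = y"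
  shows "equicontinuous_extension G X a Y b \<phi>"
  unfolding equicontinuous_extension_def
proof (intro conjI allI impI)
  fix \<alpha> assume \<alpha>: "diagonal_nbhd X \<alpha>"
  let ?\<beta> = "{p \<in> topspace (prod_topology X X). \<sigma> (fst p) = \<sigma> (snd p)}"
  have "continuous_map (prod_topology X X) (discrete_topology S) (\<lambda>p. \<sigma> (fst p))"
    and "continuous_map (prod_topology X X) (discrete_topology S) (\<lambda>p. \<sigma> (snd p))"
    using continuous_map_compose[OF continuous_map_fst \<sigma>] continuous_map_compose[OF continuous_map_snd \<sigma>]
    by (simp_all add: comp_def)
  then have "continuous_map (prod_topology X X) (prod_topology (discrete_topology S) (discrete_topology S))
      (\<lambda>p. (\<sigma> (fst p), \<sigma> (snd p)))"
    by (rule continuous_map_pairedI)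
  then have "openin (prod_topology X X) {p \<in> topspace (prod_topology X X). (\<sigma> (fst p), \<sigma> (snd p)) \<in> Id \<inter> S \<times> S}"
    by (rule openin_continuous_map_preimage) (auto simp flip: prod_topology_discrete_topology)
  also have "{p \<in> topspace (prod_topology X X). (\<sigma> (fst p), \<sigma> (snd p)) \<in> Id \<inter> S \<times> S} = ?\<beta>"
    using \<sigma> by (auto simp: continuous_map_def)
  finally have "diagonal_nbhd X ?\<beta>"
    unfolding diagonal_nbhd_def by auto
  moreover have "(a g x, a g y) \<in> \<alpha>"
    if "g \<in> carrier G" "(x, y) \<in> ?\<beta>" "\<phi> x = \<phi> y" for g x y
  proof -
    have "x = y" "x \<in> topspace X"
      using that sep by auto
    then have "a g x \<in> topspace X" "a g x = a g y"
      using flow_action_closed[OF assms(2) that(1)] by auto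
    then show ?thesis
      using \<alpha> by (auto simp: diagonal_nbhd_def)
  qed
  ultimately show "\<exists>\<beta>. diagonal_nbhd X \<beta> \<and> (\<forall>g\<in>carrier G. \<forall>(x, y)\<in>\<beta>. \<phi> x = \<phi> y \<longrightarrow> (a g x, a g y) \<in> \<alpha>)"
    by blast
qed (rule hom)

section \<open>Finite towers\<close>

text \<open>Finer and finer factors of one minimal flow, numbered by \<open>0, \<dots>, n\<close>, form a tower once every
  step is proximal or equicontinuous: the connecting maps are induced by the factor maps, so they
  are coherent, and there are no limit stages.  The injection \<open>e\<close> only serves to name the stages by
  elements of the index type.\<close>

lemma finite_PI_tower:
  fixes e :: "nat \<Rightarrow> 'i" and n :: nat
  assumes min: "minimal_flow G T X a"
    and e: "inj_on e {..n}"
    and haus: "\<And>k. k \<le> n \<Longrightarrow> Hausdorff_space (W k)"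
    and q: "\<And>k. k \<le> n \<Longrightarrow> flow_hom G X a (W k) (b k) (q k)"
    and surj: "\<And>k. k \<le> n \<Longrightarrow> q k ` topspace X = topspace (W k)"
    and finer: "\<And>j k x y. j \<le> k \<Longrightarrow> k \<le> n \<Longrightarrow> x \<in> topspace X \<Longrightarrow> y \<in> topspace X \<Longrightarrow>
      q k x = q k y \<Longrightarrow> q j x = q j y"
    and trivial: "topspace (W 0) = {w}"
    and step: "\<And>k \<psi>. k < n \<Longrightarrow> flow_hom G (W (Suc k)) (b (Suc k)) (W k) (b k) \<psi> \<Longrightarrow>
      (\<And>x. x \<in> topspace X \<Longrightarrow> \<psi> (q (Suc k) x) = q k x) \<Longrightarrow>
      proximal_extension G (W (Suc k)) (b (Suc k)) (W k) (b k) \<psi> \<or>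
      equicontinuous_extension G (W (Suc k)) (b (Suc k)) (W k) (b k) \<psi>"
  shows "\<exists>r W' b' \<pi>. PI_tower G T r (e n) W' b' \<pi> \<and> W' (e n) = W n \<and> b' (e n) = b n"
proof -
  define r where "r = {(e j, e k) |j k. j \<le> k \<and> k \<le> n}"
  define m where "m = inv_into {..n} e"
  define p where "p j k w = q k (inv_into (topspace X) (q j) w)" for j k w
  have m: "m (e k) = k" if "k \<le> n" for k
    using e that by (simp add: m_def)
  have eeq: "e j = e k \<longleftrightarrow> j = k" if "j \<le> n" "k \<le> n" for j k
    using e that by (auto simp: inj_on_def)
  have r_iff: "(e j, e k) \<in> r \<longleftrightarrow> j \<le> k" if "j \<le> n" "k \<le> n" for j k
  proof
    assume "(e j, e k) \<in> r"
    then obtain j' k' where "e j = e j'" "e k = e k'" "j' \<le> k'" "k' \<le> n"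
      unfolding r_def by blast
    then show "j \<le> k"
      using eeq[of j j'] eeq[of k k'] that by simp
  qed (use that in \<open>auto simp: r_def\<close>)
  have Field: "Field r = e ` {..n}"
    by (auto simp: r_def Field_def)
  have under: "under r (e k) = e ` {..k}" if "k \<le> n" for k
    using that eeq by (auto simp: under_def r_def)
  have underS: "underS r (e k) = e ` {..<k}" if "k \<le> n" for k
  proof -
    have "underS r (e k) = under r (e k) - {e k}"
      by (auto simp: underS_def under_def)
    also have "\<dots> = e ` {..k} - e ` {k}"
      by (simp add: under that)
    also have "\<dots> = e ` ({..k} - {k})"
      by (rule inj_on_image_set_diff[OF e, symmetric]) (use that in auto)
    also have "{..k} - {k} = {..<k}"
      by auto
    finally show ?thesis .
  qed
  have wf: "wf (r - Id)"
  proof (rule wf_subset)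
    show "r - Id \<subseteq> Wellfounded.measure m"
      by (auto simp: r_def m le_less)
  qed simp
  have "Well_order r"
    unfolding well_order_on_def linear_order_on_def partial_order_on_def preorder_on_def
  proof (intro conjI)
    show "r \<subseteq> Field r \<times> Field r"
      by (auto simp: Field_def)
    show "Refl r"
      unfolding refl_on_def Field using r_iff by auto
    show "trans r"
    proof (rule transI)
      fix x y z assume "(x, y) \<in> r" "(y, z) \<in> r"
      then obtain i j j' k where "x = e i" "y = e j" "y = e j'" "z = e k"
          "i \<le> j" "j \<le> n" "j' \<le> k" "k \<le> n"
        unfolding r_def by blast
      moreover from this have "j = j'"
        using eeq[of j j'] by simp
      ultimately show "(x, z) \<in> r"
        using r_iff[of i k] by simp
    qed
    show "antisym r"
    proof (rule antisymI)
      fix x y assume "(x, y) \<in> r" "(y, x) \<in> r"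
      moreover from this obtain i j where "x = e i" "y = e j" "i \<le> j" "j \<le> n"
        unfolding r_def by blast
      ultimately show "x = y"
        using r_iff[of j i] by simp
    qed
    show "Total r"
      unfolding total_on_def Field using r_iff by auto
    show "wf (r - Id)"
      by (rule wf)
  qed
  have pq: "p j k (q j x) = q k x" if "k \<le> j" "j \<le> n" "x \<in> topspace X" for j k x
  proof -
    have "q j x \<in> q j ` topspace X"
      using that by blast
    then have "inv_into (topspace X) (q j) (q j x) \<in> topspace X"
        "q j (inv_into (topspace X) (q j) (q j x)) = q j x"
      by (auto simp: inv_into_into f_inv_into_f)
    then show ?thesis
      unfolding p_def using finer[of k j] that by blast
  qed
  have fl: "flow G T X a"
    using min by (simp add: minimal_flow_def)
  have comp: "compact_space X"
    using fl by (simp add: flow_def)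
  have quot: "quotient_map X (W k) (q k)" if "k \<le> n" for k
    using q[OF that] by (intro continuous_imp_quotient_map comp haus surj that) (simp add: flow_hom_def)
  have lift: "\<exists>x\<in>topspace X. v = q k x" if "k \<le> n" "v \<in> topspace (W k)" for k v
    using surj that by blast
  have phom: "flow_hom G (W j) (b j) (W k) (b k) (p j k)" if kj: "k \<le> j" "j \<le> n" for j k
    unfolding flow_hom_def
  proof (intro conjI ballI)
    show "continuous_map (W j) (W k) (p j k)"
    proof (rule continuous_compose_quotient_map[OF quot[OF kj(2)]])
      have "continuous_map X (W k) (q k)"
        using q[of k] kj by (simp add: flow_hom_def)
      then show "continuous_map X (W k) (p j k \<circ> q j)"
        by (rule continuous_map_eq) (simp add: pq kj)
    qed
    fix g v assume g: "g \<in> carrier G" and v: "v \<in> topspace (W j)"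
    obtain x where x: "x \<in> topspace X" "v = q j x"
      using lift v kj by blast
    have "a g x \<in> topspace X"
      by (rule flow_action_closed[OF fl g x(1)])
    have "p j k (b j g v) = p j k (q j (a g x))"
      using q[of j] g x kj by (simp add: flow_hom_def)
    also have "\<dots> = q k (a g x)"
      using pq \<open>a g x \<in> topspace X\<close> kj by simp
    also have "\<dots> = b k g (p j k v)"
      using q[of k] g x kj by (simp add: flow_hom_def pq)
    finally show "p j k (b j g v) = b k g (p j k v)" .
  qed
  have "PI_tower G T r (e n) (\<lambda>\<iota>. W (m \<iota>)) (\<lambda>\<iota>. b (m \<iota>)) (\<lambda>\<iota> \<kappa>. p (m \<iota>) (m \<kappa>))"
    unfolding PI_tower_def
  proof (intro conjI)
    show "Well_order r" by fact
    show "e n \<in> Field r"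
      by (simp add: Field)
    show "\<forall>\<iota>\<in>under r (e n). minimal_flow G T (W (m \<iota>)) (b (m \<iota>))"
    proof
      fix \<iota> assume "\<iota> \<in> under r (e n)"
      then obtain k where k: "k \<le> n" "\<iota> = e k"
        by (auto simp: under)
      then show "minimal_flow G T (W (m \<iota>)) (b (m \<iota>))"
        using q[of k] by (auto simp: m flow_hom_def intro!: factor_minimal_flow[OF min _ surj haus])
    qed
    show "\<forall>\<iota>\<in>under r (e n). \<forall>\<kappa>\<in>under r \<iota>.
        flow_hom G (W (m \<iota>)) (b (m \<iota>)) (W (m \<kappa>)) (b (m \<kappa>)) (p (m \<iota>) (m \<kappa>))"
      using phom by (auto simp: under m)
    show "\<forall>\<iota>\<in>under r (e n). \<forall>w\<in>topspace (W (m \<iota>)). p (m \<iota>) (m \<iota>) w = w"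
      by (auto simp: under m dest!: lift[rotated] simp: pq)
    show "\<forall>\<iota>\<in>under r (e n). \<forall>\<kappa>\<in>under r \<iota>. \<forall>\<mu>\<in>under r \<kappa>. \<forall>w\<in>topspace (W (m \<iota>)).
        p (m \<kappa>) (m \<mu>) (p (m \<iota>) (m \<kappa>) w) = p (m \<iota>) (m \<mu>) w"
      by (auto simp: under m dest!: lift[rotated] simp: pq)
    show "\<forall>\<iota>\<in>under r (e n). underS r \<iota> = {} \<longrightarrow> (\<exists>w. topspace (W (m \<iota>)) = {w})"
      using trivial by (auto simp: under underS m lessThan_empty_iff bot_nat_def)
    show "\<forall>\<kappa>\<in>under r (e n). \<forall>\<iota>\<in>underS r \<kappa>. underS r \<kappa> = under r \<iota> \<longrightarrow>
        proximal_extension G (W (m \<kappa>)) (b (m \<kappa>)) (W (m \<iota>)) (b (m \<iota>)) (p (m \<kappa>) (m \<iota>)) \<or>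
        equicontinuous_extension G (W (m \<kappa>)) (b (m \<kappa>)) (W (m \<iota>)) (b (m \<iota>)) (p (m \<kappa>) (m \<iota>))"
    proof (intro ballI impI)
      fix \<kappa> \<iota> assume \<kappa>: "\<kappa> \<in> under r (e n)" and \<iota>: "\<iota> \<in> underS r \<kappa>" and eq: "underS r \<kappa> = under r \<iota>"
      obtain k where k: "k \<le> n" "\<kappa> = e k"
        using \<kappa> by (auto simp: under)
      obtain j where j: "j < k" "\<iota> = e j"
        using \<iota> k by (auto simp: underS)
      have "e ` {..<k} = e ` {..j}"
        using eq j k by (simp add: under underS)
      then have "{..<k} = {..j}"
        by (subst (asm) inj_on_image_eq_iff[OF e]) (use j k in auto)
      then have "k = Suc j"
        using j(1) by (metis Suc_leI atMost_iff lessThan_iff le_neq_implies_less not_less_eq_eq lessI)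
      then show "proximal_extension G (W (m \<kappa>)) (b (m \<kappa>)) (W (m \<iota>)) (b (m \<iota>)) (p (m \<kappa>) (m \<iota>)) \<or>
          equicontinuous_extension G (W (m \<kappa>)) (b (m \<kappa>)) (W (m \<iota>)) (b (m \<iota>)) (p (m \<kappa>) (m \<iota>))"
        using step[OF _ phom pq, of j] j k by (simp add: m)
    qed
    \<comment> \<open>every stage but the first is a successor\<close>
    show "\<forall>\<nu>\<in>under r (e n). underS r \<nu> \<noteq> {} \<and> (\<forall>\<iota>\<in>underS r \<nu>. underS r \<nu> \<noteq> under r \<iota>) \<longrightarrow>
        homeomorphic_map (W (m \<nu>))
          (subtopology (product_topology (\<lambda>\<iota>. W (m \<iota>)) (underS r \<nu>))
             {x. \<forall>\<iota>\<in>underS r \<nu>. \<forall>\<kappa>\<in>under r \<iota>. p (m \<iota>) (m \<kappa>) (x \<iota>) = x \<kappa>})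
          (\<lambda>w. \<lambda>\<iota>\<in>underS r \<nu>. p (m \<nu>) (m \<iota>) w)"
    proof (intro ballI impI)
      fix \<nu> assume \<nu>: "\<nu> \<in> under r (e n)"
        and lim: "underS r \<nu> \<noteq> {} \<and> (\<forall>\<iota>\<in>underS r \<nu>. underS r \<nu> \<noteq> under r \<iota>)"
      obtain k where k: "k \<le> n" "\<nu> = e k"
        using \<nu> by (auto simp: under)
      then obtain j where j: "k = Suc j"
        using lim by (cases k) (auto simp: underS)
      then have "e j \<in> underS r \<nu>" "underS r \<nu> = under r (e j)"
        using k by (auto simp: under underS lessThan_Suc_atMost)
      then have False
        using lim by blast
      then show "homeomorphic_map (W (m \<nu>))
          (subtopology (product_topology (\<lambda>\<iota>. W (m \<iota>)) (underS r \<nu>))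
             {x. \<forall>\<iota>\<in>underS r \<nu>. \<forall>\<kappa>\<in>under r \<iota>. p (m \<iota>) (m \<kappa>) (x \<iota>) = x \<kappa>})
          (\<lambda>w. \<lambda>\<iota>\<in>underS r \<nu>. p (m \<nu>) (m \<iota>) w)" ..
    qed
  qed
  moreover have "m (e n) = n"
    by (simp add: m)
  ultimately show ?thesis
    by (intro exI[of _ r] exI[of _ "\<lambda>\<iota>. W (m \<iota>)"] exI[of _ "\<lambda>\<iota>. b (m \<iota>)"]
        exI[of _ "\<lambda>\<iota> \<kappa>. p (m \<iota>) (m \<kappa>)"]) simp
qed

section \<open>Equicontinuous extensions of proximal flows\<close>

lemma ex_homeomorphic_copy:
  assumes "inj_on f (topspace X)"
  shows "\<exists>Y. homeomorphic_map X Y f"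
proof -
  let ?i = "inv_into (topspace X) f"
  let ?Y = "pullback_topology (f ` topspace X) ?i X"
  have i: "?i (f x) = x" if "x \<in> topspace X" for x
    using assms that by simp
  have Y: "topspace ?Y = f ` topspace X"
    using i by (auto simp: topspace_pullback_topology)
  have "continuous_map X X (?i \<circ> f)"
    by (rule continuous_map_eq[OF continuous_map_id]) (simp add: i)
  then have "continuous_map X ?Y f"
    by (rule continuous_map_pullback') auto
  moreover have "continuous_map ?Y X ?i"
    using continuous_map_pullback[OF continuous_map_id, of "f ` topspace X" ?i X] by simp
  ultimately have "homeomorphic_maps X ?Y f ?i"
    using i Y by (auto simp: homeomorphic_maps_def)
  then show ?thesis
    by (auto simp: homeomorphic_maps_map)
qed

text \<open>The tower is \<open>X \<rightarrow> Z \<rightarrow> point\<close>.  Towers live on subsets of \<open>'g set set\<close>; the injection \<open>\<iota>\<close>, composed with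
  a section of \<open>\<phi>\<close> in the case of \<open>Z\<close>, transports both flows there.  The proximal extension from the
  strictly PI flow onto \<open>X\<close> is then the isomorphism from the copy of \<open>X\<close> back to \<open>X\<close>.\<close>

lemma PI_flow_if_equicontinuous_over_proximal:
  fixes \<iota> :: "'x \<Rightarrow> 'g set set" and a :: "'g \<Rightarrow> 'x \<Rightarrow> 'x"
  assumes min: "minimal_flow G T X a" and haus: "Hausdorff_space Z"
    and \<phi>: "flow_hom G X a Z b \<phi>" and surj: "\<phi> ` topspace X = topspace Z"
    and prox: "\<And>z1 z2. z1 \<in> topspace Z \<Longrightarrow> z2 \<in> topspace Z \<Longrightarrow> proximal_pair G Z b z1 z2"
    and \<sigma>: "continuous_map X (discrete_topology S) \<sigma>"
    and sep: "\<And>x y. x \<in> topspace X \<Longrightarrow> y \<in> topspace X \<Longrightarrow> \<phi> x = \<phi> y \<Longrightarrow> \<sigma> x = \<sigma> y \<Longrightarrow> x = y"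
    and \<iota>: "inj_on \<iota> (topspace X)"
  shows "PI_flow G T X a"
proof -
  have fl: "flow G T X a"
    using min by (simp add: minimal_flow_def)
  have \<phi>cont: "continuous_map X Z \<phi>"
    and \<phi>eq: "\<And>g x. g \<in> carrier G \<Longrightarrow> x \<in> topspace X \<Longrightarrow> \<phi> (a g x) = b g (\<phi> x)"
    using \<phi> by (auto simp: flow_hom_def)
  have \<phi>Z: "\<phi> x \<in> topspace Z" if "x \<in> topspace X" for x
    using surj that by blast
  have flZ: "flow G T Z b"
    by (rule factor_flow[OF fl \<phi>cont surj haus]) (rule \<phi>eq)
  have aX: "a g x \<in> topspace X" if "g \<in> carrier G" "x \<in> topspace X" for g x
    by (rule flow_action_closed[OF fl that])
  define \<kappa> where "\<kappa> = \<iota> \<circ> inv_into (topspace X) \<phi>"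
  have "inj_on (inv_into (topspace X) \<phi>) (topspace Z)"
    using inj_on_inv_into[of "topspace Z" \<phi> "topspace X"] surj by simp
  moreover have "inv_into (topspace X) \<phi> ` topspace Z \<subseteq> topspace X"
    using inv_into_into[of _ \<phi> "topspace X"] surj by auto
  ultimately have \<kappa>: "inj_on \<kappa> (topspace Z)"
    unfolding \<kappa>_def by (intro comp_inj_on inj_on_subset[OF \<iota>])
  obtain WX where WX: "homeomorphic_map X WX \<iota>"
    using ex_homeomorphic_copy[OF \<iota>] by blast
  obtain WZ where WZ: "homeomorphic_map Z WZ \<kappa>"
    using ex_homeomorphic_copy[OF \<kappa>] by blast
  define i where "i = inv_into (topspace X) \<iota>"
  define j where "j = inv_into (topspace Z) \<kappa>"
  have i: "i (\<iota> x) = x" if "x \<in> topspace X" for x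
    using \<iota> that by (simp add: i_def)
  have j: "j (\<kappa> z) = z" if "z \<in> topspace Z" for z
    using \<kappa> that by (simp add: j_def)
  define W where "W k = (if k = 0 then discrete_topology {{}} else if k = 1 then WZ else WX)" for k :: nat
  define c where "c k = (if k = 0 then (\<lambda>g w. w) else if k = 1 then (\<lambda>g w. \<kappa> (b g (j w)))
    else (\<lambda>g w. \<iota> (a g (i w))))" for k :: nat
  define q where "q k = (if k = 0 then (\<lambda>x. {}) else if k = 1 then \<kappa> \<circ> \<phi> else \<iota>)" for k :: nat
  define e :: "nat \<Rightarrow> 'g set set" where "e k = (if k = 0 then {} else if k = 1 then {{}} else UNIV)" for k
  have le2: "k = 0 \<or> k = 1 \<or> k = 2" if "k \<le> 2" for k :: nat
    using that by auto
  have homX: "flow_hom G X a WX (c 2) \<iota>"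
    using homeomorphic_imp_continuous_map[OF WX] i by (simp add: flow_hom_def c_def)
  have homZ: "flow_hom G Z b WZ (c 1) \<kappa>"
    using homeomorphic_imp_continuous_map[OF WZ] j by (simp add: flow_hom_def c_def)
  have q: "flow_hom G X a (W k) (c k) (q k)" if "k \<le> 2" for k
  proof -
    have "flow_hom G X a (W 1) (c 1) (q 1)"
      using \<phi> homZ \<phi>Z unfolding flow_hom_def W_def q_def
      by (auto intro: continuous_map_compose)
    moreover have "flow_hom G X a (W 0) (c 0) (q 0)"
      by (simp add: flow_hom_def W_def c_def q_def)
    moreover have "flow_hom G X a (W 2) (c 2) (q 2)"
      using homX by (simp add: W_def q_def)
    ultimately show ?thesis
      using le2[OF that] by auto
  qed
  have imX: "\<iota> ` topspace X = topspace WX" and imZ: "\<kappa> ` topspace Z = topspace WZ"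
    by (rule homeomorphic_imp_surjective_map[OF WX], rule homeomorphic_imp_surjective_map[OF WZ])
  have hausX: "Hausdorff_space X"
    using fl by (simp add: flow_def)
  have hausW: "Hausdorff_space (W k)" for k
    using hausX haus homeomorphic_Hausdorff_space[OF homeomorphic_map_imp_homeomorphic_space[OF WX]]
      homeomorphic_Hausdorff_space[OF homeomorphic_map_imp_homeomorphic_space[OF WZ]] by (simp add: W_def)
  have qsurj: "q k ` topspace X = topspace (W k)" if "k \<le> 2" for k
  proof -
    have "q 0 ` topspace X = topspace (W 0)"
      using fl by (auto simp: flow_def q_def W_def image_constant_conv)
    moreover have "q 1 ` topspace X = topspace (W 1)"
      using imZ unfolding surj[symmetric] image_comp by (simp add: q_def W_def)
    moreover have "q 2 ` topspace X = topspace (W 2)"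
      by (simp add: q_def W_def imX)
    ultimately show ?thesis
      using le2[OF that] by auto
  qed
  have W2: "W 2 = WX"
    by (simp add: W_def)
  have minW: "minimal_flow G T WX (c 2)"
  proof (rule factor_minimal_flow[OF min _ imX])
    show "continuous_map X WX \<iota>"
      by (rule homeomorphic_imp_continuous_map[OF WX])
    show "Hausdorff_space WX"
      using hausW[of 2] by (simp add: W2)
  qed (use homX in \<open>simp add: flow_hom_def\<close>)
  have icont: "continuous_map WX X i"
  proof (rule continuous_compose_quotient_map)
    show "quotient_map X WX \<iota>"
      using WX by (simp add: homeomorphic_map_def)
    show "continuous_map X X (i \<circ> \<iota>)"
      by (rule continuous_map_eq[OF continuous_map_id]) (simp add: i)
  qed
  have "\<exists>r W' b' \<pi>. PI_tower G T r (e 2) W' b' \<pi> \<and> W' (e 2) = W 2 \<and> b' (e 2) = c 2"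
  proof (rule finite_PI_tower[OF min])
    show "inj_on e {..2}"
    proof (rule inj_onI)
      fix k l assume "k \<in> {..2}" "l \<in> {..2}" and eq: "e k = e l"
      moreover have "{{}} \<noteq> (UNIV :: 'g set set)"
        by (metis UNIV_I UNIV_not_empty singletonD)
      ultimately show "k = l"
        using le2[of k] le2[of l] by (auto simp: e_def)
    qed
    show "topspace (W 0) = {{}}"
      by (simp add: W_def)
    show "q k x = q k y \<Longrightarrow> q l x = q l y"
      if lk: "l \<le> k" "k \<le> 2" and xy: "x \<in> topspace X" "y \<in> topspace X" for k l x y
    proof -
      assume eq: "q k x = q k y"
      consider "l = 0" | "l = k" | "l = 1" "k = 2"
        using le2[OF lk(2)] lk(1) by force
      then show "q l x = q l y"
      proof cases
        case 3
        then have "x = y"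
          using eq inj_onD[OF \<iota> _ xy] by (simp add: q_def)
        then show ?thesis
          by simp
      qed (use eq in \<open>simp_all add: q_def\<close>)
    qed
    fix k \<psi> assume k: "k < (2 :: nat)" and hom: "flow_hom G (W (Suc k)) (c (Suc k)) (W k) (c k) \<psi>"
      and \<psi>: "\<And>x. x \<in> topspace X \<Longrightarrow> \<psi> (q (Suc k) x) = q k x"
    consider "k = 0" | "k = 1"
      using k by linarith
    then show "proximal_extension G (W (Suc k)) (c (Suc k)) (W k) (c k) \<psi> \<or>
        equicontinuous_extension G (W (Suc k)) (c (Suc k)) (W k) (c k) \<psi>"
    proof cases
      case 1
      have "proximal_pair G WZ (c 1) w1 w2" if w: "w1 \<in> topspace WZ" "w2 \<in> topspace WZ" for w1 w2
      proof -
        obtain z1 z2 where z: "z1 \<in> topspace Z" "w1 = \<kappa> z1" "z2 \<in> topspace Z" "w2 = \<kappa> z2"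
          using w unfolding imZ[symmetric] by blast
        show ?thesis
          unfolding z(2,4) by (rule proximal_pair_flow_hom[OF homZ z(1,3) prox[OF z(1,3)]])
      qed
      then have "proximal_extension G (W (Suc k)) (c (Suc k)) (W k) (c k) \<psi>"
        using hom 1 by (simp add: proximal_extension_def W_def)
      then show ?thesis ..
    next
      case 2
      have Suc: "Suc k = 2" "W 2 = WX" "q 2 = \<iota>" "q 1 = \<kappa> \<circ> \<phi>"
        using 2 by (simp_all add: W_def q_def)
      have "equicontinuous_extension G WX (c 2) (W k) (c k) \<psi>"
      proof (rule equicontinuous_extension_if_separated_by_labels)
        show "flow_hom G WX (c 2) (W k) (c k) \<psi>"
          using hom by (simp add: Suc)
        show "flow G T WX (c 2)"
          using minW by (simp add: minimal_flow_def)
        show "continuous_map WX (discrete_topology S) (\<sigma> \<circ> i)"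
          using icont \<sigma> by (rule continuous_map_compose)
        fix v w assume v: "v \<in> topspace WX" and w: "w \<in> topspace WX"
          and eq: "\<psi> v = \<psi> w" "(\<sigma> \<circ> i) v = (\<sigma> \<circ> i) w"
        obtain x y where xy: "x \<in> topspace X" "v = \<iota> x" "y \<in> topspace X" "w = \<iota> y"
          using v w unfolding imX[symmetric] by blast
        have "\<kappa> (\<phi> x) = \<kappa> (\<phi> y)"
          using eq(1) \<psi>[OF xy(1)] \<psi>[OF xy(3)] xy(2,4) 2 by (simp add: q_def)
        then have "\<phi> x = \<phi> y"
          using inj_onD[OF \<kappa> _ \<phi>Z \<phi>Z] xy(1,3) by blast
        moreover have "\<sigma> x = \<sigma> y"
          using eq(2) xy i by simp
        ultimately show "v = w"
          using sep xy by blast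
      qed
      then show ?thesis
        by (simp add: Suc)
    qed
  qed (use q qsurj hausW in auto)
  then obtain r W' b' \<pi> where tower: "PI_tower G T r (e 2) W' b' \<pi>" "W' (e 2) = W 2" "b' (e 2) = c 2"
    by blast
  have "flow_iso G (W' (e 2)) (b' (e 2)) WX (c 2) id"
    by (simp add: flow_iso_def flow_hom_def tower W2)
  then have "strictly_PI G T WX (c 2)"
    unfolding strictly_PI_def using tower(1) minW by blast
  moreover have "proximal_extension G WX (c 2) X a i"
    unfolding proximal_extension_def
  proof (intro conjI ballI impI)
    have "i (c 2 g w) = a g (i w)" if "g \<in> carrier G" "w \<in> topspace WX" for g w
      using that aX unfolding imX[symmetric] by (auto simp: c_def i)
    then show "flow_hom G WX (c 2) X a i"
      by (simp add: flow_hom_def icont)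
    fix v w assume v: "v \<in> topspace WX" and w: "w \<in> topspace WX" and eq: "i v = i w"
    have "v = w"
      using eq v w unfolding imX[symmetric] by (auto simp: i)
    then show "proximal_pair G WX (c 2) v w"
      using proximal_pair_refl[of G T WX "c 2"] minW v by (simp add: minimal_flow_def)
  qed
  ultimately show ?thesis
    unfolding PI_flow_def using min by blast
qed

section \<open>The Cantor set\<close>

lemma compact_Cantor_space: "compact_space Cantor_space"
  by (auto simp: Cantor_space_def compact_space_product_topology compact_space_discrete_topology)

lemma Hausdorff_Cantor_space: "Hausdorff_space Cantor_space"
  by (simp add: Cantor_space_def Hausdorff_space_product_topology)

lemma topspace_Cantor_space: "topspace Cantor_space = UNIV"
  by (simp add: Cantor_space_def)

text \<open>Flipping the \<open>n\<close>-th coordinate of a point gives pairwise different points that converge to it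
  as \<open>n\<close> grows.\<close>

lemma infinite_open_Cantor_space:
  assumes "openin Cantor_space V" "V \<noteq> {}"
  shows "infinite V"
proof
  assume fin: "finite V"
  obtain x where x: "x \<in> V"
    using assms(2) by blast
  define y where "y n = x(n := \<not> x n)" for n :: nat
  have "limitin Cantor_space y x sequentially"
    unfolding Cantor_space_def limitin_componentwise
  proof (intro conjI ballI)
    fix i :: nat
    have "y n i = x i" if "Suc i \<le> n" for n
      using that by (simp add: y_def)
    then have "\<forall>\<^sub>F n in sequentially. y n i = x i"
      by (rule eventually_sequentiallyI)
    then show "limitin (discrete_topology UNIV) (\<lambda>n. y n i) (x i) sequentially"
      by (auto simp: limitin_def elim: eventually_mono)
  qed auto
  then have "\<forall>\<^sub>F n in sequentially. y n \<in> V"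
    using assms(1) x by (simp add: limitin_def)
  then obtain N where N: "\<And>n. n \<ge> N \<Longrightarrow> y n \<in> V"
    by (auto simp: eventually_sequentially)
  have "inj_on y {N..}"
  proof (rule inj_onI)
    fix m n assume "y m = y n"
    then have "y m m = y n m"
      by simp
    then show "m = n"
      by (simp add: y_def split: if_splits)
  qed
  moreover have "y ` {N..} \<subseteq> V"
    using N by auto
  ultimately have "finite {N..}"
    using fin finite_subset finite_imageD by blast
  then show False
    by (simp add: infinite_Ici)
qed

lemma infinite_open_if_homeomorphic_Cantor_space:
  assumes "Z homeomorphic_space Cantor_space" "openin Z V" "V \<noteq> {}"
  shows "infinite V"
proof -
  obtain f where f: "homeomorphic_map Z Cantor_space f"
    using assms(1) homeomorphic_space by blast
  have "openin Cantor_space (f ` V)"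
    using homeomorphic_imp_open_map[OF f] assms(2) by (simp add: open_map_def)
  then have "infinite (f ` V)"
    using infinite_open_Cantor_space assms(3) by blast
  then show ?thesis
    by blast
qed

lemma eqpoll_if_homeomorphic_Cantor_space:
  assumes "Z homeomorphic_space Cantor_space"
  shows "topspace Z \<approx> Pow (UNIV :: nat set)"
proof -
  obtain f where "homeomorphic_map Z Cantor_space f"
    using assms homeomorphic_space by blast
  then have "bij_betw f (topspace Z) (UNIV :: (nat \<Rightarrow> bool) set)"
    by (auto simp: homeomorphic_eq_everything_map bij_betw_def topspace_Cantor_space)
  moreover have "bij_betw Collect (UNIV :: (nat \<Rightarrow> bool) set) (Pow UNIV)"
    by (rule bij_betwI[where g = "\<lambda>A n. n \<in> A"]) auto
  ultimately show ?thesis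
    using bij_betw_trans unfolding eqpoll_def by blast
qed

section \<open>Fibre maps of the double cover\<close>

lemma Z2_cases: "\<epsilon> \<in> Z2 \<longleftrightarrow> \<epsilon> = 1 \<or> \<epsilon> = -1"
  by (auto simp: Z2_def)

lemma Z2_mult: "\<delta> \<in> Z2 \<Longrightarrow> \<epsilon> \<in> Z2 \<Longrightarrow> \<delta> * \<epsilon> \<in> Z2"
  by (auto simp: Z2_cases)

lemma Z2_self_mult: "\<epsilon> \<in> Z2 \<Longrightarrow> \<epsilon> * \<epsilon> = 1"
  by (auto simp: Z2_cases)

lemma Z2_self_mult_left: "\<epsilon> \<in> Z2 \<Longrightarrow> \<epsilon> * (\<epsilon> * \<delta>) = \<delta>"
  by (auto simp: Z2_cases)

lemma one_in_Z2: "1 \<in> Z2" and minus_one_in_Z2: "-1 \<in> Z2"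
  by (auto simp: Z2_def)

lemma sign_cocycle_in_Z2: "sign_cocycle A z \<in> Z2"
  by (simp add: sign_cocycle_def Z2_def)

lemma topspace_skew_space: "topspace (skew_space Z) = topspace Z \<times> Z2"
  by (simp add: skew_space_def)

text \<open>The self-maps of \<open>Z \<times> Z2\<close> that are equivariant under the sign change in the fibres: such a
  map is given by an arbitrary self-map of \<open>Z\<close> and an arbitrary choice of signs.  They form the
  enveloping semigroup of the flow.\<close>

definition fibre_maps :: "'z topology \<Rightarrow> ('z \<times> int \<Rightarrow> 'z \<times> int) set" where
  "fibre_maps Z = {p \<in> topspace (skew_space Z) \<rightarrow>\<^sub>E topspace (skew_space Z).
     \<forall>z\<in>topspace Z. p (z, -1) = apsnd uminus (p (z, 1))}"

lemma fibre_maps_closed: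
  assumes "p \<in> fibre_maps Z" "z \<in> topspace Z" "\<epsilon> \<in> Z2"
  shows "fst (p (z, \<epsilon>)) \<in> topspace Z" "snd (p (z, \<epsilon>)) \<in> Z2"
proof -
  have "p (z, \<epsilon>) \<in> topspace Z \<times> Z2"
    using assms by (auto simp: fibre_maps_def topspace_skew_space)
  then show "fst (p (z, \<epsilon>)) \<in> topspace Z" "snd (p (z, \<epsilon>)) \<in> Z2"
    by auto
qed

lemma fibre_maps_apply:
  assumes "p \<in> fibre_maps Z" "z \<in> topspace Z" "\<epsilon> \<in> Z2"
  shows "p (z, \<epsilon>) = (fst (p (z, 1)), snd (p (z, 1)) * \<epsilon>)"
  using assms by (cases "p (z, 1)") (auto simp: fibre_maps_def Z2_cases)

lemma fibre_mapsI:
  assumes "p \<in> extensional (topspace (skew_space Z))"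
    and "\<And>z \<epsilon>. z \<in> topspace Z \<Longrightarrow> \<epsilon> \<in> Z2 \<Longrightarrow> p (z, \<epsilon>) = (h z, s z * \<epsilon>)"
    and "\<And>z. z \<in> topspace Z \<Longrightarrow> h z \<in> topspace Z" "\<And>z. z \<in> topspace Z \<Longrightarrow> s z \<in> Z2"
  shows "p \<in> fibre_maps Z"
  using assms Z2_mult
  by (auto simp: fibre_maps_def topspace_skew_space PiE_def Pi_def one_in_Z2 minus_one_in_Z2)

lemma fibre_maps_compose:
  assumes "p \<in> fibre_maps Z" "q \<in> fibre_maps Z"
  shows "compose (topspace (skew_space Z)) p q \<in> fibre_maps Z"
proof (rule fibre_mapsI)
  fix z \<epsilon> assume z: "z \<in> topspace Z" and \<epsilon>: "\<epsilon> \<in> Z2"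
  have "compose (topspace (skew_space Z)) p q (z, \<epsilon>) = p (fst (q (z, 1)), snd (q (z, 1)) * \<epsilon>)"
    using z \<epsilon> fibre_maps_apply[OF assms(2) z \<epsilon>] by (simp add: compose_def topspace_skew_space)
  also have "\<dots> = (fst (p (fst (q (z, 1)), 1)), snd (p (fst (q (z, 1)), 1)) * (snd (q (z, 1)) * \<epsilon>))"
    by (intro fibre_maps_apply[OF assms(1)] fibre_maps_closed[OF assms(2)] Z2_mult z \<epsilon> one_in_Z2)
  finally show "compose (topspace (skew_space Z)) p q (z, \<epsilon>)
      = (fst (p (fst (q (z, 1)), 1)), (snd (p (fst (q (z, 1)), 1)) * snd (q (z, 1))) * \<epsilon>)"
    by (simp add: mult.assoc)
qed (auto intro: fibre_maps_closed[OF assms(1)] fibre_maps_closed[OF assms(2)] Z2_mult one_in_Z2)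

text \<open>The maps over a constant map of \<open>Z\<close>; up to a global sign \<open>\<delta>\<close> the choice of signs is
  the set \<open>A\<close> on which they change.\<close>

definition constant_fibre_map :: "'z topology \<Rightarrow> 'z set \<Rightarrow> 'z \<Rightarrow> int \<Rightarrow> 'z \<times> int \<Rightarrow> 'z \<times> int" where
  "constant_fibre_map Z A w \<delta> = (\<lambda>(z, \<epsilon>) \<in> topspace (skew_space Z). (w, \<delta> * sign_cocycle A z * \<epsilon>))"

lemma constant_fibre_map_apply:
  "z \<in> topspace Z \<Longrightarrow> \<epsilon> \<in> Z2 \<Longrightarrow>
    constant_fibre_map Z A w \<delta> (z, \<epsilon>) = (w, \<delta> * sign_cocycle A z * \<epsilon>)"
  by (simp add: constant_fibre_map_def topspace_skew_space)

lemma constant_fibre_map_in_fibre_maps: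
  assumes "w \<in> topspace Z" "\<delta> \<in> Z2"
  shows "constant_fibre_map Z A w \<delta> \<in> fibre_maps Z"
proof (rule fibre_mapsI[where h = "\<lambda>_. w" and s = "\<lambda>z. \<delta> * sign_cocycle A z"])
  show "constant_fibre_map Z A w \<delta> \<in> extensional (topspace (skew_space Z))"
    by (simp add: constant_fibre_map_def)
qed (use assms in \<open>auto simp: constant_fibre_map_apply intro: Z2_mult sign_cocycle_in_Z2\<close>)

lemma compose_constant_fibre_map:
  assumes "p \<in> fibre_maps Z" "w \<in> topspace Z" "\<delta> \<in> Z2"
  shows "compose (topspace (skew_space Z)) p (constant_fibre_map Z A w \<delta>)
    = constant_fibre_map Z A (fst (p (w, 1))) (snd (p (w, 1)) * \<delta>)" (is "?l = ?r")
proof (rule extensionalityI)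
  show "?l \<in> extensional (topspace (skew_space Z))" "?r \<in> extensional (topspace (skew_space Z))"
    by (simp_all add: constant_fibre_map_def)
  fix x assume "x \<in> topspace (skew_space Z)"
  then obtain z \<epsilon> where x: "x = (z, \<epsilon>)" "z \<in> topspace Z" "\<epsilon> \<in> Z2"
    by (auto simp: topspace_skew_space)
  have "?l x = p (w, \<delta> * sign_cocycle A z * \<epsilon>)"
    using x by (simp add: compose_def topspace_skew_space constant_fibre_map_apply)
  also have "\<dots> = (fst (p (w, 1)), snd (p (w, 1)) * (\<delta> * sign_cocycle A z * \<epsilon>))"
    by (intro fibre_maps_apply[OF assms(1,2)] Z2_mult assms(3) x(3) sign_cocycle_in_Z2)
  finally show "?l x = ?r x"
    using x by (simp add: constant_fibre_map_apply mult.assoc)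
qed

lemma compose_constant_fibre_map_left:
  assumes "q \<in> fibre_maps Z" "w \<in> topspace Z"
  shows "compose (topspace (skew_space Z)) (constant_fibre_map Z {} w 1) q
    = constant_fibre_map Z {z. snd (q (z, 1)) = -1} w 1" (is "?l = ?r")
proof (rule extensionalityI)
  show "?l \<in> extensional (topspace (skew_space Z))" "?r \<in> extensional (topspace (skew_space Z))"
    by (simp_all add: constant_fibre_map_def)
  fix x assume "x \<in> topspace (skew_space Z)"
  then obtain z \<epsilon> where x: "x = (z, \<epsilon>)" "z \<in> topspace Z" "\<epsilon> \<in> Z2"
    by (auto simp: topspace_skew_space)
  have s: "snd (q (z, 1)) \<in> Z2" and f: "fst (q (z, 1)) \<in> topspace Z"
    using fibre_maps_closed[OF assms(1) x(2) one_in_Z2] by auto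
  have "?l x = constant_fibre_map Z {} w 1 (fst (q (z, 1)), snd (q (z, 1)) * \<epsilon>)"
    using x fibre_maps_apply[OF assms(1) x(2,3)] by (simp add: compose_def topspace_skew_space)
  also have "\<dots> = (w, snd (q (z, 1)) * \<epsilon>)"
    using constant_fibre_map_apply[OF f Z2_mult[OF s x(3)]] by (simp add: sign_cocycle_def)
  finally show "?l x = ?r x"
    using x s by (auto simp: constant_fibre_map_apply sign_cocycle_def Z2_cases)
qed

section \<open>Left ideals in the semigroup of fibre maps\<close>

text \<open>The left ideal generated by any of the maps \<open>constant_fibre_map Z A w \<delta>\<close>: composing with a fibre map
  changes \<open>w\<close> and the global sign \<open>\<delta>\<close>, but never \<open>A\<close>.\<close>

definition constant_ideal :: "'z topology \<Rightarrow> 'z set \<Rightarrow> ('z \<times> int \<Rightarrow> 'z \<times> int) set" where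
  "constant_ideal Z A = {constant_fibre_map Z A w \<delta> |w \<delta>. w \<in> topspace Z \<and> \<delta> \<in> Z2}"

lemma constant_ideal_subset_fibre_maps: "constant_ideal Z A \<subseteq> fibre_maps Z"
  using constant_fibre_map_in_fibre_maps by (auto simp: constant_ideal_def)

lemma constant_ideal_compose:
  assumes "p \<in> fibre_maps Z" "q \<in> constant_ideal Z A"
  shows "compose (topspace (skew_space Z)) p q \<in> constant_ideal Z A"
proof -
  obtain w \<delta> where q: "q = constant_fibre_map Z A w \<delta>" "w \<in> topspace Z" "\<delta> \<in> Z2"
    using assms(2) by (auto simp: constant_ideal_def)
  show ?thesis
    unfolding q(1) compose_constant_fibre_map[OF assms(1) q(2,3)] constant_ideal_def
    using fibre_maps_closed[OF assms(1) q(2) one_in_Z2] q(3) Z2_mult by blast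
qed

text \<open>Composing on the left with maps over constant maps moves any element of the ideal to any
  other, so the ideal is generated by each of its elements.\<close>

lemma constant_ideal_generated:
  assumes "q \<in> constant_ideal Z A" "r \<in> constant_ideal Z A"
  shows "\<exists>p\<in>fibre_maps Z. r = compose (topspace (skew_space Z)) p q"
proof -
  obtain w \<delta> where q: "q = constant_fibre_map Z A w \<delta>" "w \<in> topspace Z" "\<delta> \<in> Z2"
    using assms(1) by (auto simp: constant_ideal_def)
  obtain w' \<delta>' where r: "r = constant_fibre_map Z A w' \<delta>'" "w' \<in> topspace Z" "\<delta>' \<in> Z2"
    using assms(2) by (auto simp: constant_ideal_def)
  let ?p = "constant_fibre_map Z {} w' (\<delta>' * \<delta>)"
  have p: "?p \<in> fibre_maps Z"
    by (intro constant_fibre_map_in_fibre_maps r Z2_mult q)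
  have "?p (w, 1) = (w', \<delta>' * \<delta>)"
    by (simp add: constant_fibre_map_apply q one_in_Z2 sign_cocycle_def)
  then have "compose (topspace (skew_space Z)) ?p q = r"
    unfolding q(1) compose_constant_fibre_map[OF p q(2,3)] r(1)
    by (simp add: mult.assoc Z2_self_mult[OF q(3)])
  then show ?thesis
    using p by blast
qed

text \<open>Passing to the complement changes all signs, which the global sign absorbs.  It is the only
  coincidence among these ideals, so fixing a point outside \<open>A\<close> makes \<open>A\<close> unique.\<close>

lemma constant_ideal_complement: "constant_ideal Z (topspace Z - A) = constant_ideal Z A"
proof -
  have *: "constant_fibre_map Z (topspace Z - A) w \<delta> = constant_fibre_map Z A w (- \<delta>)" for w \<delta>
    by (auto simp: constant_fibre_map_def restrict_def topspace_skew_space sign_cocycle_def)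
  have "- \<delta> \<in> Z2 \<longleftrightarrow> \<delta> \<in> Z2" for \<delta>
    by (auto simp: Z2_cases)
  then show ?thesis
    unfolding constant_ideal_def * by (auto; metis minus_minus)
qed

lemma constant_ideal_inj:
  assumes z0: "z0 \<in> topspace Z"
  shows "inj_on (constant_ideal Z) (Pow (topspace Z - {z0}))"
proof (rule inj_onI)
  fix A B assume A: "A \<in> Pow (topspace Z - {z0})" and B: "B \<in> Pow (topspace Z - {z0})"
    and eq: "constant_ideal Z A = constant_ideal Z B"
  have "constant_fibre_map Z A z0 1 \<in> constant_ideal Z B"
    unfolding eq[symmetric] using z0 one_in_Z2 by (auto simp: constant_ideal_def)
  then obtain w \<delta> where w: "constant_fibre_map Z A z0 1 = constant_fibre_map Z B w \<delta>"
    by (auto simp: constant_ideal_def)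
  \<comment> \<open>Neither set contains \<open>z0\<close>, so evaluating there identifies the global sign.\<close>
  have "z0 \<notin> A" "z0 \<notin> B"
    using A B by auto
  then have "\<delta> = 1"
    using fun_cong[OF w, of "(z0, 1)"]
    by (simp add: constant_fibre_map_apply z0 one_in_Z2 sign_cocycle_def)
  then have "sign_cocycle A z = sign_cocycle B z" if "z \<in> topspace Z" for z
    using fun_cong[OF w, of "(z, 1)"] by (simp add: constant_fibre_map_apply that one_in_Z2)
  then have "z \<in> A \<longleftrightarrow> z \<in> B" if "z \<in> topspace Z" for z
    using that by (force simp: sign_cocycle_def split: if_splits)
  then show "A = B"
    using A B by blast
qed

text \<open>Every left ideal contains a \<open>constant_ideal\<close>: compose any of its elements on the left with
  the map \<open>(z, \<epsilon>) \<mapsto> (z0, \<epsilon>)\<close>.\<close>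

lemma minimal_left_ideals_fibre_maps:
  assumes E: "enveloping_semigroup G (skew_space Z) a = fibre_maps Z" and z0: "z0 \<in> topspace Z"
  shows "{I. minimal_left_ideal G (skew_space Z) a I}
    = constant_ideal Z ` Pow (topspace Z - {z0})"
proof -
  let ?L = "left_ideal G (skew_space Z) a" and ?C = "constant_ideal Z"
  have left: "?L I \<longleftrightarrow> I \<noteq> {} \<and> I \<subseteq> fibre_maps Z \<and>
      (\<forall>p\<in>fibre_maps Z. \<forall>q\<in>I. compose (topspace (skew_space Z)) p q \<in> I)" for I
    by (simp add: left_ideal_def E)
  have mem: "constant_fibre_map Z A z0 1 \<in> ?C A" for A
    unfolding constant_ideal_def using z0 one_in_Z2 by blast
  have CL: "?L (?C A)" for A
    unfolding left
  proof (intro conjI ballI)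
    show "?C A \<noteq> {}"
      using mem by blast
  qed (use constant_ideal_subset_fibre_maps constant_ideal_compose in \<open>auto\<close>)
  have generated: "?C A \<subseteq> I" if I: "?L I" and q: "q \<in> I" "q \<in> ?C A" for I A q
  proof
    fix r assume "r \<in> ?C A"
    then obtain p where "p \<in> fibre_maps Z" "r = compose (topspace (skew_space Z)) p q"
      using constant_ideal_generated[OF q(2)] by blast
    then show "r \<in> I"
      using I q(1) by (simp add: left)
  qed
  have contains: "\<exists>A. ?C A \<subseteq> I" if I: "?L I" for I
  proof -
    obtain q where q: "q \<in> I" "q \<in> fibre_maps Z"
      using I by (auto simp: left)
    let ?A = "{z. snd (q (z, 1)) = -1}"
    have "constant_fibre_map Z {} z0 1 \<in> fibre_maps Z"
      by (rule constant_fibre_map_in_fibre_maps[OF z0 one_in_Z2])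
    then have "compose (topspace (skew_space Z)) (constant_fibre_map Z {} z0 1) q \<in> I"
      using I q(1) by (simp add: left)
    then have "constant_fibre_map Z ?A z0 1 \<in> I"
      by (simp add: compose_constant_fibre_map_left[OF q(2) z0])
    from generated[OF I this mem] show ?thesis
      by blast
  qed
  have min: "minimal_left_ideal G (skew_space Z) a (?C A)" for A
    unfolding minimal_left_ideal_def
  proof (intro conjI CL notI)
    assume "\<exists>J. ?L J \<and> J \<subset> ?C A"
    then obtain J where J: "?L J" "J \<subset> ?C A" by blast
    then obtain q where "q \<in> J"
      by (auto simp: left)
    then show False
      using generated[OF J(1)] J(2) by blast
  qed
  show ?thesis
  proof (intro equalityI subsetI)
    fix I assume "I \<in> {I. minimal_left_ideal G (skew_space Z) a I}"
    then have I: "?L I" "\<And>J. ?L J \<Longrightarrow> J \<subseteq> I \<Longrightarrow> J = I"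
      by (auto simp: minimal_left_ideal_def)
    obtain A where "?C A \<subseteq> I"
      using contains[OF I(1)] by blast
    then have A: "I = ?C A"
      using I(2)[OF CL] by blast
    define B where "B = (if z0 \<in> A then topspace Z - A else topspace Z - (topspace Z - A))"
    have "I = ?C B"
      unfolding A B_def by (simp add: constant_ideal_complement)
    moreover have "B \<in> Pow (topspace Z - {z0})"
      using z0 by (auto simp: B_def)
    ultimately show "I \<in> ?C ` Pow (topspace Z - {z0})"
      by blast
  qed (use min in auto)
qed

section \<open>The skew product\<close>

lemma inj_choice_from_infinite_sets:
  assumes "finite F" "\<And>z. z \<in> F \<Longrightarrow> infinite (V z)"
  shows "\<exists>w. inj_on w F \<and> (\<forall>z\<in>F. w z \<in> V z)"
  using assms
proof (induction F)
  case (insert z F)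
  then obtain w where w: "inj_on w F" "\<forall>z\<in>F. w z \<in> V z"
    by auto
  have "infinite (V z - w ` F)"
    using insert by (simp add: Diff_infinite_finite)
  then obtain v where v: "v \<in> V z" "v \<notin> w ` F"
    by (metis DiffE ex_in_conv finite.emptyI)
  have "inj_on (w(z := v)) F"
    using w(1) insert.hyps by (subst inj_on_cong[of F _ w]) auto
  then have "inj_on (w(z := v)) (insert z F)"
    using v(2) insert.hyps by auto
  moreover have "\<forall>y\<in>insert z F. (w(z := v)) y \<in> V y"
    using v(1) w(2) by simp
  ultimately show ?case
    by blast
qed simp

locale skew_product =
  fixes Z :: "'z topology" and G0 :: "('z \<Rightarrow> 'z) set" and U :: "'z set"
  assumes compact: "compact_space Z" and Hausdorff: "Hausdorff_space Z"
    and perfect: "\<And>V. openin Z V \<Longrightarrow> V \<noteq> {} \<Longrightarrow> infinite V"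
    and subgroup: "subgroup G0 (Homeo Z)"
    and totally_minimal: "totally_minimal (subgroup_of_Homeo Z G0) Z (\<lambda>\<gamma>. \<gamma>)"
    and U: "openin Z U" "closedin Z U" "U \<noteq> {}" "U \<noteq> topspace Z"
begin

abbreviation X where "X \<equiv> skew_space Z"
abbreviation G where "G \<equiv> skew_group Z G0 U"
abbreviation grp where "grp \<equiv> subgroup_of_Homeo X G"
abbreviation grp_top where "grp_top \<equiv> subgroup_topology X G"

lemma carrier_grp: "carrier grp = G"
  by (simp add: subgroup_of_Homeo_def)

text \<open>Total minimality in terms of open sets.  Since open sets are infinite, the targets can be
  chosen distinct even if the prescribed open sets overlap or coincide.\<close>

lemma simultaneous_move:
  assumes F: "finite F" "F \<subseteq> topspace Z"
    and V: "\<And>z. z \<in> F \<Longrightarrow> openin Z (V z)" "\<And>z. z \<in> F \<Longrightarrow> V z \<noteq> {}"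
  shows "\<exists>\<gamma>\<in>G0. \<forall>z\<in>F. \<gamma> z \<in> V z"
proof -
  obtain w where w: "inj_on w F" "\<forall>z\<in>F. w z \<in> V z"
    using inj_choice_from_infinite_sets[OF F(1), of V] perfect[OF V] by auto
  obtain zs where zs: "set zs = F" "distinct zs"
    using finite_distinct_list[OF F(1)] by blast
  have "set (map w zs) \<subseteq> topspace Z"
    using w(2) openin_subset[OF V(1)] zs(1) by auto
  moreover have "distinct (map w zs)"
    using w(1) zs by (simp add: distinct_map)
  ultimately obtain \<gamma> :: "nat \<Rightarrow> 'z \<Rightarrow> 'z" where \<gamma>: "range \<gamma> \<subseteq> G0"
      and lim: "\<forall>i<length zs. limitin Z (\<lambda>j. \<gamma> j (zs ! i)) (map w zs ! i) sequentially"
    using totally_minimal[unfolded totally_minimal_def, rule_format, of zs "length zs" "map w zs"] zs F(2)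
    by (auto simp: subgroup_of_Homeo_def)
  have "\<forall>\<^sub>F j in sequentially. \<gamma> j z \<in> V z" if z: "z \<in> F" for z
  proof -
    obtain i where i: "i < length zs" "zs ! i = z"
      using z zs(1) by (auto simp: in_set_conv_nth)
    then have "limitin Z (\<lambda>j. \<gamma> j z) (w z) sequentially"
      using lim by auto
    then show ?thesis
      using V(1)[OF z] w(2) z by (simp add: limitin_def)
  qed
  then have "\<forall>\<^sub>F j in sequentially. \<forall>z\<in>F. \<gamma> j z \<in> V z"
    using F(1) by (simp add: eventually_ball_finite_distrib)
  then obtain j where "\<forall>z\<in>F. \<gamma> j z \<in> V z"
    by (auto simp: eventually_sequentially)
  then show ?thesis
    using \<gamma> by blast
qed

lemma compact_X: "compact_space X"
  using compact by (simp add: skew_space_def compact_space_prod_topology compact_space_discrete_topology Z2_def)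

lemma Hausdorff_X: "Hausdorff_space X"
  using Hausdorff by (simp add: skew_space_def Hausdorff_space_prod_topology)

lemma skew_lift_apply: "z \<in> topspace Z \<Longrightarrow> \<epsilon> \<in> Z2 \<Longrightarrow> skew_lift Z \<gamma> (z, \<epsilon>) = (\<gamma> z, \<epsilon>)"
  by (simp add: skew_lift_def topspace_skew_space)

lemma skew_flip_apply:
  "z \<in> topspace Z \<Longrightarrow> \<epsilon> \<in> Z2 \<Longrightarrow> skew_flip Z U (z, \<epsilon>) = (z, sign_cocycle U z * \<epsilon>)"
  by (simp add: skew_flip_def topspace_skew_space)

lemma continuous_map_skew_lift:
  assumes "continuous_map Z Z \<gamma>"
  shows "continuous_map X X (\<lambda>x. (\<gamma> (fst x), snd x))"
  unfolding skew_space_def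
  using continuous_map_compose[OF continuous_map_fst assms]
  by (intro continuous_map_pairedI continuous_map_snd) (simp add: comp_def)

lemma skew_lift_in_Homeo:
  assumes "\<gamma> \<in> carrier (Homeo Z)"
  shows "skew_lift Z \<gamma> \<in> carrier (Homeo X)"
proof -
  obtain \<gamma>' where \<gamma>': "homeomorphic_maps Z Z \<gamma> \<gamma>'"
    using assms by (auto simp: carrier_Homeo homeomorphic_map_maps)
  have "homeomorphic_maps X X (\<lambda>x. (\<gamma> (fst x), snd x)) (\<lambda>x. (\<gamma>' (fst x), snd x))"
    using \<gamma>' continuous_map_skew_lift
    by (auto simp: homeomorphic_maps_def topspace_skew_space)
  then have "homeomorphic_map X X (\<lambda>x. (\<gamma> (fst x), snd x))"
    by (simp add: homeomorphic_maps_map)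
  then have "homeomorphic_map X X (skew_lift Z \<gamma>)"
    by (rule homeomorphic_map_eq) (auto simp: topspace_skew_space skew_lift_apply)
  then show ?thesis
    by (simp add: carrier_Homeo skew_lift_def)
qed

lemma skew_flip_in_Homeo: "skew_flip Z U \<in> carrier (Homeo X)"
proof -
  let ?s = "\<lambda>x :: 'z \<times> int. sign_cocycle U (fst x) * snd x"
  have "continuous_map Z (discrete_topology Z2) (sign_cocycle U)"
  proof -
    have "openin Z {z \<in> topspace Z. sign_cocycle U z \<in> A}" for A
    proof -
      have "{z \<in> topspace Z. sign_cocycle U z \<in> A}
          = (if -1 \<in> A then U else {}) \<union> (if 1 \<in> A then topspace Z - U else {})"
        using openin_subset[OF U(1)] by (auto simp: sign_cocycle_def)
      then show ?thesis
        using U(1,2) by (auto simp: openin_diff)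
    qed
    then show ?thesis
      by (simp add: continuous_map_def sign_cocycle_in_Z2)
  qed
  then have "continuous_map X (discrete_topology Z2) (\<lambda>x. sign_cocycle U (fst x))"
    unfolding skew_space_def using continuous_map_compose[OF continuous_map_fst] by (simp add: comp_def)
  moreover have "continuous_map X (discrete_topology Z2) snd"
    unfolding skew_space_def by (rule continuous_map_snd)
  ultimately have "continuous_map X (prod_topology (discrete_topology Z2) (discrete_topology Z2))
      (\<lambda>x. (sign_cocycle U (fst x), snd x))"
    by (rule continuous_map_pairedI)
  moreover have "continuous_map (prod_topology (discrete_topology Z2) (discrete_topology Z2))
      (discrete_topology Z2) (\<lambda>p. fst p * snd p)"
    using Z2_mult by (auto simp flip: prod_topology_discrete_topology)
  ultimately have "continuous_map X (discrete_topology Z2) ?s"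
    using continuous_map_compose by (fastforce simp: comp_def)
  moreover have "continuous_map X Z fst"
    unfolding skew_space_def by (rule continuous_map_fst)
  ultimately have cont: "continuous_map X X (\<lambda>x. (fst x, ?s x))"
    unfolding skew_space_def by (intro continuous_map_pairedI)
  have "homeomorphic_maps X X (\<lambda>x. (fst x, ?s x)) (\<lambda>x. (fst x, ?s x))"
    using cont by (auto simp: homeomorphic_maps_def Z2_self_mult_left[OF sign_cocycle_in_Z2])
  then have "homeomorphic_map X X (\<lambda>x. (fst x, ?s x))"
    by (simp add: homeomorphic_maps_map)
  then have "homeomorphic_map X X (skew_flip Z U)"
    by (rule homeomorphic_map_eq) (auto simp: topspace_skew_space skew_flip_apply)
  then show ?thesis
    by (simp add: carrier_Homeo skew_flip_def)
qed

lemma generators_in_Homeo: "skew_lift Z ` G0 \<union> {skew_flip Z U} \<subseteq> carrier (Homeo X)"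
  using skew_lift_in_Homeo skew_flip_in_Homeo subgroup.subset[OF subgroup] by auto

lemma subgroup_G: "subgroup G (Homeo X)"
  unfolding skew_group_def by (rule group.generate_is_subgroup[OF group_Homeo generators_in_Homeo])

lemma G_subset_Homeo: "G \<subseteq> carrier (Homeo X)"
  by (rule subgroup.subset[OF subgroup_G])

lemma skew_lift_in_G: "\<gamma> \<in> G0 \<Longrightarrow> skew_lift Z \<gamma> \<in> G"
  unfolding skew_group_def by (rule generate.incl) blast

lemma skew_flip_in_G: "skew_flip Z U \<in> G"
  unfolding skew_group_def by (rule generate.incl) blast

lemma compose_in_G: "g \<in> G \<Longrightarrow> h \<in> G \<Longrightarrow> compose (topspace X) g h \<in> G"
  using subgroup.m_closed[OF subgroup_G, of g h] mult_Homeo[of g X h]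
    subsetD[OF G_subset_Homeo, of g] subsetD[OF G_subset_Homeo, of h] by simp

lemma inv_fibre_maps:
  assumes g: "g \<in> carrier (Homeo X)" "g \<in> fibre_maps Z"
  shows "inv\<^bsub>Homeo X\<^esub> g \<in> fibre_maps Z"
proof -
  have bij: "bij_betw g (topspace X) (topspace X)"
    by (rule Homeo_bij_betw[OF g(1)])
  let ?i = "inv_into (topspace X) g"
  have i: "?i x \<in> topspace X" "g (?i x) = x" if "x \<in> topspace X" for x
    using bij_betwE[OF bij_betw_inv_into[OF bij]] bij_betw_inv_into_right[OF bij] that by auto
  have "?i (z, -1) = apsnd uminus (?i (z, 1))" if z: "z \<in> topspace Z" for z
  proof -
    obtain w \<epsilon> where w: "?i (z, 1) = (w, \<epsilon>)" "w \<in> topspace Z" "\<epsilon> \<in> Z2"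
      using i(1)[of "(z, 1)"] z by (cases "?i (z, 1)") (auto simp: topspace_skew_space one_in_Z2)
    have \<epsilon>': "- \<epsilon> \<in> Z2"
      using w(3) by (auto simp: Z2_cases)
    have "g (w, \<epsilon>) = (z, 1)"
      using i(2)[of "(z, 1)"] z w(1) by (simp add: topspace_skew_space one_in_Z2)
    then have "g (w, - \<epsilon>) = (z, -1)"
      using fibre_maps_apply[OF g(2) w(2,3)] fibre_maps_apply[OF g(2) w(2) \<epsilon>'] by simp
    then have "?i (z, -1) = (w, - \<epsilon>)"
      using bij_betw_inv_into_left[OF bij, of "(w, - \<epsilon>)"] w \<epsilon>' by (simp add: topspace_skew_space)
    then show ?thesis
      by (simp add: w(1))
  qed
  then show ?thesis
    using i(1) unfolding inv_Homeo[OF g(1)]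
    by (auto simp: fibre_maps_def topspace_skew_space one_in_Z2 minus_one_in_Z2)
qed

lemma generator_fibre_map:
  assumes "g \<in> skew_lift Z ` G0 \<union> {skew_flip Z U}"
  shows "g \<in> fibre_maps Z"
proof -
  consider \<gamma> where "\<gamma> \<in> G0" "g = skew_lift Z \<gamma>" | "g = skew_flip Z U"
    using assms by blast
  then show ?thesis
  proof cases
    case 1
    then have "\<gamma> \<in> carrier (Homeo Z)"
      using subgroup.subset[OF subgroup] by auto
    note \<gamma> = Homeo_closed[OF this]
    then show ?thesis
      unfolding 1(2)
      by (intro fibre_mapsI[where h = \<gamma> and s = "\<lambda>_. 1"])
        (simp_all add: skew_lift_apply one_in_Z2 \<gamma>, simp add: skew_lift_def)
  next
    case 2
    show ?thesis
      unfolding 2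
      by (rule fibre_mapsI[where h = "\<lambda>z. z" and s = "sign_cocycle U"])
        (simp_all add: skew_flip_apply sign_cocycle_in_Z2, simp add: skew_flip_def)
  qed
qed

lemma G_subset_fibre_maps: "G \<subseteq> fibre_maps Z"
proof
  fix g assume "g \<in> G"
  then have "g \<in> generate (Homeo X) (skew_lift Z ` G0 \<union> {skew_flip Z U})"
    by (simp add: skew_group_def)
  then have "g \<in> carrier (Homeo X) \<and> g \<in> fibre_maps Z"
  proof (induction rule: generate.induct)
    case one
    have "\<one>\<^bsub>Homeo X\<^esub> \<in> fibre_maps Z"
      unfolding one_Homeo
      by (rule fibre_mapsI[where h = "\<lambda>z. z" and s = "\<lambda>_. 1"]) (auto simp: topspace_skew_space one_in_Z2)
    then show ?case
      using monoid.one_closed[OF group.is_monoid[OF group_Homeo]] by simp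
  next
    case (incl h)
    then show ?case
      using subsetD[OF generators_in_Homeo] generator_fibre_map by simp
  next
    case (inv h)
    then have h: "h \<in> carrier (Homeo X)" "h \<in> fibre_maps Z"
      by (rule subsetD[OF generators_in_Homeo], rule generator_fibre_map)
    show ?case
      using group.inv_closed[OF group_Homeo h(1)] inv_fibre_maps[OF h] by simp
  next
    case (eng h1 h2)
    then have "h1 \<in> carrier (Homeo X)" "h2 \<in> carrier (Homeo X)" "h1 \<in> fibre_maps Z" "h2 \<in> fibre_maps Z"
      by auto
    then show ?case
      using monoid.m_closed[OF group.is_monoid[OF group_Homeo], of h1 X h2]
      by (simp add: mult_Homeo fibre_maps_compose)
  qed
  then show "g \<in> fibre_maps Z" ..
qed

section \<open>The enveloping semigroup of the skew product\<close>

lemma nonempty_Z: "topspace Z \<noteq> {}"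
  using U(1,3) openin_subset by blast

lemma nonempty_X: "topspace X \<noteq> {}"
  using nonempty_Z one_in_Z2 by (auto simp: topspace_skew_space)

lemma openin_slice:
  assumes "openin X W" "\<epsilon> \<in> Z2"
  shows "openin Z {w \<in> topspace Z. (w, \<epsilon>) \<in> W}"
proof -
  have "continuous_map Z X (\<lambda>w. (w, \<epsilon>))"
    unfolding skew_space_def using assms(2) by (intro continuous_map_pairedI) auto
  then show ?thesis
    using assms(1) by (rule openin_continuous_map_preimage)
qed

text \<open>Given finitely many points of \<open>Z\<close>, first move those whose sign has to be changed into \<open>U\<close>
  and the others off \<open>U\<close>, then flip, then move all of them to their targets.\<close>

lemma fibre_map_approximation:
  assumes p: "p \<in> fibre_maps Z" and F: "finite F" "F \<subseteq> topspace X"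
    and W: "\<And>x. x \<in> F \<Longrightarrow> openin X (W x)" "\<And>x. x \<in> F \<Longrightarrow> p x \<in> W x"
  shows "\<exists>g\<in>G. \<forall>x\<in>F. g x \<in> W x"
proof -
  define s where "s z = snd (p (z, 1))" for z
  define W' where "W' x = (if x \<in> F then W x else topspace X)" for x
  \<comment> \<open>Both points over \<open>z\<close> are steered at once: \<open>V z\<close> is the set of base points that are good targets
    for whichever of them lie in \<open>F\<close>.\<close>
  define V where "V z = {w \<in> topspace Z. (w, s z) \<in> W' (z, 1)} \<inter> {w \<in> topspace Z. (w, - s z) \<in> W' (z, -1)}" for z
  define F' where "F' = fst ` F"
  have F': "finite F'" "F' \<subseteq> topspace Z"
    using F by (auto simp: F'_def topspace_skew_space)
  have s: "s z \<in> Z2" "- s z \<in> Z2" if "z \<in> topspace Z" for z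
    using fibre_maps_closed(2)[OF p that one_in_Z2] by (auto simp: s_def Z2_cases)
  have W': "openin X (W' x)" for x
    using W(1) by (simp add: W'_def)
  have pW': "p x \<in> W' x" if "x \<in> topspace X" for x
    using W(2) that p by (auto simp: W'_def fibre_maps_def)
  have Vopen: "openin Z (V z)" if "z \<in> F'" for z
    unfolding V_def using s[of z] F'(2) that by (intro openin_Int openin_slice W') auto
  have Vne: "V z \<noteq> {}" if "z \<in> F'" for z
  proof -
    have z: "z \<in> topspace Z"
      using F'(2) that by auto
    have "p (z, 1) \<in> W' (z, 1)" "p (z, -1) \<in> W' (z, -1)"
      using z by (auto intro!: pW' simp: topspace_skew_space one_in_Z2 minus_one_in_Z2)
    then have "fst (p (z, 1)) \<in> V z"
      using fibre_maps_apply[OF p z minus_one_in_Z2] fibre_maps_closed(1)[OF p z one_in_Z2]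
      by (simp add: V_def s_def)
    then show ?thesis
      by blast
  qed
  have "\<exists>\<gamma>\<in>G0. \<forall>z\<in>F'. \<gamma> z \<in> (if s z = -1 then U else topspace Z - U)"
  proof (rule simultaneous_move[OF F'])
    show "openin Z (if s z = -1 then U else topspace Z - U)" for z
      using U(1,2) by (simp add: openin_diff)
    show "(if s z = -1 then U else topspace Z - U) \<noteq> {}" for z
      using U(3,4) openin_subset[OF U(1)] by auto
  qed
  then obtain \<gamma>1 where \<gamma>1: "\<gamma>1 \<in> G0" "\<And>z. z \<in> F' \<Longrightarrow> \<gamma>1 z \<in> (if s z = -1 then U else topspace Z - U)"
    by blast
  have \<gamma>1H: "\<gamma>1 \<in> carrier (Homeo Z)"
    using subsetD[OF subgroup.subset[OF subgroup] \<gamma>1(1)] .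
  have inj: "inj_on \<gamma>1 F'"
    using Homeo_bij_betw[OF \<gamma>1H] F'(2) by (auto simp: bij_betw_def intro: inj_on_subset)
  have "\<exists>\<gamma>\<in>G0. \<forall>y\<in>\<gamma>1 ` F'. \<gamma> y \<in> V (inv_into F' \<gamma>1 y)"
  proof (rule simultaneous_move)
    show "\<gamma>1 ` F' \<subseteq> topspace Z"
      using Homeo_closed[OF \<gamma>1H] F'(2) by auto
  qed (use F'(1) Vopen Vne inv_into_into[of _ \<gamma>1 F'] in auto)
  then obtain \<gamma>2 where \<gamma>2: "\<gamma>2 \<in> G0" "\<And>z. z \<in> F' \<Longrightarrow> \<gamma>2 (\<gamma>1 z) \<in> V z"
    using inj by auto
  define g where "g = compose (topspace X) (skew_lift Z \<gamma>2)
    (compose (topspace X) (skew_flip Z U) (skew_lift Z \<gamma>1))"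
  have "g \<in> G"
    unfolding g_def by (intro compose_in_G skew_lift_in_G skew_flip_in_G \<gamma>1 \<gamma>2)
  moreover have "g x \<in> W x" if "x \<in> F" for x
  proof -
    obtain z \<epsilon> where x: "x = (z, \<epsilon>)" "z \<in> F'" "z \<in> topspace Z" "\<epsilon> \<in> Z2"
      using \<open>x \<in> F\<close> F(2) by (force simp: F'_def topspace_skew_space)
    have sg: "sign_cocycle U (\<gamma>1 z) = s z"
      using \<gamma>1(2)[OF x(2)] s(1)[OF x(3)] by (auto simp: sign_cocycle_def Z2_cases split: if_splits)
    have z1: "\<gamma>1 z \<in> topspace Z"
      using Homeo_closed[OF \<gamma>1H] x(3) by blast
    have "g x = (\<gamma>2 (\<gamma>1 z), s z * \<epsilon>)"
      using x z1 Z2_mult[OF s(1)[OF x(3)] x(4)]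
      by (simp add: g_def compose_def topspace_skew_space skew_lift_apply skew_flip_apply sg)
    moreover have "(\<gamma>2 (\<gamma>1 z), s z) \<in> W' (z, 1)" "(\<gamma>2 (\<gamma>1 z), - s z) \<in> W' (z, -1)"
      using \<gamma>2(2)[OF x(2)] by (auto simp: V_def)
    ultimately have "g x \<in> W' x"
      using x(1,4) by (auto simp: Z2_cases)
    then show ?thesis
      using that by (simp add: W'_def)
  qed
  ultimately show ?thesis
    by blast
qed

lemma continuous_map_sign_change: "continuous_map X X (apsnd uminus)"
proof -
  have "continuous_map (discrete_topology Z2) (discrete_topology Z2) uminus"
    by (auto simp: Z2_cases)
  then have "continuous_map X (discrete_topology Z2) (uminus \<circ> snd)"
    unfolding skew_space_def by (rule continuous_map_compose[OF continuous_map_snd])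
  moreover have "continuous_map X Z fst"
    unfolding skew_space_def by (rule continuous_map_fst)
  ultimately have "continuous_map X X (\<lambda>x. (fst x, (uminus \<circ> snd) x))"
    unfolding skew_space_def by (intro continuous_map_pairedI) (simp_all add: comp_def)
  then show ?thesis
    by (rule continuous_map_eq) (simp add: apsnd_def map_prod_def split_beta)
qed

lemma closedin_fibre_maps: "closedin (product_topology (\<lambda>_. X) (topspace X)) (fibre_maps Z)"
proof -
  let ?P = "product_topology (\<lambda>_. X) (topspace X)"
  let ?S = "\<lambda>z. {p \<in> topspace ?P. p (z, -1) = (apsnd uminus \<circ> (\<lambda>p. p (z, 1))) p}"
  have "closedin ?P (?S z)" if z: "z \<in> topspace Z" for z
  proof (rule closedin_continuous_maps_eq[OF Hausdorff_X])
    show "continuous_map ?P X (\<lambda>p. p (z, -1))"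
      by (rule continuous_map_product_projection) (simp add: topspace_skew_space z minus_one_in_Z2)
    have "continuous_map ?P X (\<lambda>p. p (z, 1))"
      by (rule continuous_map_product_projection) (simp add: topspace_skew_space z one_in_Z2)
    then show "continuous_map ?P X (apsnd uminus \<circ> (\<lambda>p. p (z, 1)))"
      by (rule continuous_map_compose[OF _ continuous_map_sign_change])
  qed
  then have "closedin ?P (\<Inter>z\<in>topspace Z. ?S z)"
    by (rule closedin_INT[OF nonempty_Z])
  also have "(\<Inter>z\<in>topspace Z. ?S z) = fibre_maps Z"
    using nonempty_Z unfolding fibre_maps_def topspace_product_topology comp_def by blast
  finally show ?thesis .
qed

text \<open>A basic neighbourhood in the product topology restricts a map at finitely many points only, so
  density of \<open>G\<close> among the fibre maps is \<open>fibre_map_approximation\<close>.\<close>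

theorem enveloping_semigroup_eq: "enveloping_semigroup grp X (\<lambda>g. g) = fibre_maps Z"
proof -
  let ?P = "product_topology (\<lambda>_. X) (topspace X)"
  have "restrict g (topspace X) = g" if "g \<in> G" for g
    using subsetD[OF G_subset_Homeo that] by (simp add: carrier_Homeo extensional_restrict)
  then have img: "(\<lambda>g. restrict g (topspace X)) ` carrier grp = G"
    by (simp add: carrier_grp)
  have "?P closure_of G \<subseteq> fibre_maps Z"
    by (rule closure_of_minimal[OF G_subset_fibre_maps closedin_fibre_maps])
  moreover have "fibre_maps Z \<subseteq> ?P closure_of G"
  proof
    fix p assume p: "p \<in> fibre_maps Z"
    show "p \<in> ?P closure_of G"
      unfolding in_closure_of
    proof (intro conjI allI impI)
      show "p \<in> topspace ?P"
        using p by (simp add: fibre_maps_def)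
      fix T assume T: "p \<in> T \<and> openin ?P T"
      then obtain W where W: "finite {x \<in> topspace X. W x \<noteq> topspace X}"
          "\<forall>x\<in>topspace X. openin X (W x)" "p \<in> Pi\<^sub>E (topspace X) W" "Pi\<^sub>E (topspace X) W \<subseteq> T"
        unfolding openin_product_topology_alt by blast
      let ?F = "{x \<in> topspace X. W x \<noteq> topspace X}"
      have "\<exists>g\<in>G. \<forall>x\<in>?F. g x \<in> W x"
        by (rule fibre_map_approximation[OF p W(1)]) (use W(2,3) in auto)
      then obtain g where g: "g \<in> G" "\<forall>x\<in>?F. g x \<in> W x"
        by blast
      have gH: "g \<in> carrier (Homeo X)"
        using subsetD[OF G_subset_Homeo g(1)] .
      have "g x \<in> W x" if "x \<in> topspace X" for x
        using bspec[OF g(2), of x] that Homeo_closed[OF gH that] by (cases "W x = topspace X") simp_all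
      then have "g \<in> Pi\<^sub>E (topspace X) W"
        using gH by (auto simp: carrier_Homeo PiE_def)
      then show "\<exists>g. g \<in> G \<and> g \<in> T"
        using W(4) g(1) by blast
    qed
  qed
  ultimately show ?thesis
    unfolding enveloping_semigroup_def img by blast
qed

section \<open>The skew product is a PI-flow\<close>

lemma minimal_flow_X: "minimal_flow grp grp_top X (\<lambda>g. g)"
  unfolding minimal_flow_def
proof (intro conjI ballI)
  show "flow grp grp_top X (\<lambda>g. g)"
    by (rule flow_subgroup_of_Homeo[OF compact_X Hausdorff_X nonempty_X subgroup_G])
  fix x assume x: "x \<in> topspace X"
  show "X closure_of (\<lambda>g. g x) ` carrier grp = topspace X"
  proof (rule antisym[OF closure_of_subset_topspace subsetI])
    fix y assume y: "y \<in> topspace X"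
    obtain z \<epsilon> where z: "x = (z, \<epsilon>)" "z \<in> topspace Z" "\<epsilon> \<in> Z2"
      using x by (auto simp: topspace_skew_space)
    obtain w \<delta> where w: "y = (w, \<delta>)" "w \<in> topspace Z" "\<delta> \<in> Z2"
      using y by (auto simp: topspace_skew_space)
    let ?p = "constant_fibre_map Z {} w (\<delta> * \<epsilon>)"
    have p: "?p \<in> fibre_maps Z"
      by (intro constant_fibre_map_in_fibre_maps Z2_mult w z)
    have px: "?p x = y"
      using z w by (simp add: constant_fibre_map_apply sign_cocycle_def mult.assoc Z2_self_mult)
    show "y \<in> X closure_of (\<lambda>g. g x) ` carrier grp"
      unfolding in_closure_of carrier_grp
    proof (intro conjI allI impI y)
      fix T assume "y \<in> T \<and> openin X T"
      then have "\<exists>g\<in>G. \<forall>x'\<in>{x}. g x' \<in> T"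
        using px x by (intro fibre_map_approximation[OF p]) auto
      then show "\<exists>y'. y' \<in> (\<lambda>g. g x) ` G \<and> y' \<in> T"
        by blast
    qed
  qed
qed

text \<open>The action on \<open>Z\<close> is read off from the sheet \<open>Z \<times> {1}\<close>; by equivariance under the sign change the
  other sheet gives the same.\<close>

definition base_action :: "('z \<times> int \<Rightarrow> 'z \<times> int) \<Rightarrow> 'z \<Rightarrow> 'z" where
  "base_action g z = fst (g (z, 1))"

lemma fst_action:
  assumes "g \<in> G" "x \<in> topspace X"
  shows "fst (g x) = base_action g (fst x)"
  using fibre_maps_apply[OF subsetD[OF G_subset_fibre_maps assms(1)], of "fst x" "snd x"] assms(2)
  by (auto simp: base_action_def topspace_skew_space)

lemma proximal_base:
  assumes "z1 \<in> topspace Z" "z2 \<in> topspace Z"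
  shows "proximal_pair grp Z base_action z1 z2"
proof (rule proximal_pairI[OF assms(1)])
  fix V assume V: "openin Z V" "z1 \<in> V"
  have "\<exists>\<gamma>\<in>G0. \<forall>z\<in>{z1, z2}. \<gamma> z \<in> V"
    by (rule simultaneous_move) (use V assms in auto)
  then obtain \<gamma> where "\<gamma> \<in> G0" "\<gamma> z1 \<in> V" "\<gamma> z2 \<in> V"
    by blast
  then show "\<exists>g\<in>carrier grp. base_action g z1 \<in> V \<and> base_action g z2 \<in> V"
    using assms skew_lift_in_G
    by (intro bexI[of _ "skew_lift Z \<gamma>"]) (auto simp: base_action_def skew_lift_apply one_in_Z2 carrier_grp)
qed

theorem PI_flow_X: "PI_flow grp grp_top X (\<lambda>g. g)"
proof (rule PI_flow_if_equicontinuous_over_proximal[OF minimal_flow_X Hausdorff])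
  show "flow_hom grp X (\<lambda>g. g) Z base_action fst"
    unfolding flow_hom_def carrier_grp using fst_action
    by (auto simp: skew_space_def continuous_map_fst)
  show "fst ` topspace X = topspace Z"
    using one_in_Z2 by (force simp: topspace_skew_space)
  show "continuous_map X (discrete_topology Z2) snd"
    unfolding skew_space_def by (rule continuous_map_snd)
  \<comment> \<open>the group elements are maps into \<open>Z \<times> int\<close>, so constant maps encode points\<close>
  show "inj_on (\<lambda>x. {{\<lambda>_. x}}) (topspace X)"
    by (auto simp: inj_on_def fun_eq_iff)
qed (auto simp: proximal_base prod_eq_iff)

end

theorem proposition4p1:
  fixes Z :: "'z topology" and G0 :: "('z \<Rightarrow> 'z) set" and U :: "'z set"
  assumes "Z homeomorphic_space Cantor_space"
    and "subgroup G0 (Homeo Z)"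
    and "\<exists>S. finite S \<and> S \<subseteq> carrier (Homeo Z) \<and> G0 = generate (Homeo Z) S"
    and "totally_minimal (subgroup_of_Homeo Z G0) Z (\<lambda>\<gamma>. \<gamma>)"
    and "openin Z U" and "closedin Z U" and "U \<noteq> {}" and "U \<noteq> topspace Z"
  defines "X \<equiv> skew_space Z"
    and "G \<equiv> skew_group Z G0 U"
  shows "PI_flow (subgroup_of_Homeo X G) (subgroup_topology X G) X (\<lambda>g. g) \<and>
    {I. minimal_left_ideal (subgroup_of_Homeo X G) X (\<lambda>g. g) I} \<approx> Pow (Pow (UNIV :: nat set))"
proof -
  interpret S: skew_product Z G0 U
  proof (rule skew_product.intro)
    show "compact_space Z"
      using homeomorphic_compact_space[OF assms(1)] compact_Cantor_space by simp
    show "Hausdorff_space Z"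
      using homeomorphic_Hausdorff_space[OF assms(1)] Hausdorff_Cantor_space by simp
    show "\<And>V. openin Z V \<Longrightarrow> V \<noteq> {} \<Longrightarrow> infinite V"
      by (rule infinite_open_if_homeomorphic_Cantor_space[OF assms(1)])
  qed (fact assms)+
  obtain z0 where z0: "z0 \<in> topspace Z"
    using S.nonempty_Z by blast
  have "infinite (topspace Z - {z0})"
    using S.perfect[of "topspace Z"] S.nonempty_Z by simp
  then have "insert z0 (topspace Z - {z0}) \<approx> topspace Z - {z0}"
    by (rule infinite_insert_eqpoll)
  then have "topspace Z - {z0} \<approx> topspace Z"
    using z0 by (simp add: insert_absorb eqpoll_sym)
  also have "topspace Z \<approx> Pow (UNIV :: nat set)"
    by (rule eqpoll_if_homeomorphic_Cantor_space[OF assms(1)])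
  finally have Pow: "Pow (topspace Z - {z0}) \<approx> Pow (Pow (UNIV :: nat set))"
    unfolding eqpoll_def by (meson bij_betw_Pow)
  have "{I. minimal_left_ideal (subgroup_of_Homeo X G) X (\<lambda>g. g) I}
      = constant_ideal Z ` Pow (topspace Z - {z0})"
    unfolding X_def G_def by (rule minimal_left_ideals_fibre_maps[OF S.enveloping_semigroup_eq z0])
  also have "\<dots> \<approx> Pow (topspace Z - {z0})"
    by (rule inj_on_image_eqpoll_self[OF constant_ideal_inj[OF z0]])
  also note Pow
  finally show ?thesis
    using S.PI_flow_X by (simp add: X_def G_def)
qed

end
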